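(* Suppose that $H$ is a non-elementary subgroup and $Q,S$ are quasiconvex subsets of a hyperbolic group $G$. Assume that for any two finite subsets $P_1,P_2$ of the group $G$ $$H\nsubseteq P_1Q^{-1}QP_2\quad\text{and}\quad H\nsubseteq P_1S^{-1}SP_2.$$ Then the (quasiconvex) subsets $T_1=Q\cup S$ and $T_2=QS$ satisfy the same property: for any $i\in\{1,2\}$ and arbitrary finite $P_1,P_2\subset G$ one has $H\nsubseteq P_1T_i^{-1}T_iP_2$.
   Context: Hyperbolic means Gromov (word) hyperbolic. A group is elementary if it has a cyclic subgroup of finite index; otherwise it is non-elementary. Fix a finite symmetrized generating set of $G$. A subset of $G$ is quasiconvex if for some $\eta\ge0$ every geodesic segment in the Cayley graph of $G$ joining two elements of the subset lies in the closed $\eta$-neighborhood of the subset. For $A,B\subseteq G$, $AB=\{ab\mid a\in A,b\in B\}$ and $A^{-1}=\{a^{-1}\mid a\in A\}$. *)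

theory Defs
  imports "HOL-Algebra.Algebra" "HOL.Real"
begin

text \<open>
  The group \<open>G\<close> comes with a generating set \<open>A\<close>; word metric, Cayley graph, hyperbolicity and
  quasiconvexity all refer to it. The Cayley graph is the right one: its edges join
  \<open>g\<close> to \<open>g \<otimes> a\<close>, so \<open>G\<close> acts on it by left translations.
\<close>

definition finite_symmetric_generating_set :: "('a, 'b) monoid_scheme \<Rightarrow> 'a set \<Rightarrow> bool" where
  "finite_symmetric_generating_set G A \<longleftrightarrow>
     finite A \<and> A \<subseteq> carrier G \<and> set_inv\<^bsub>G\<^esub> A = A \<and> generate G A = carrier G"

definition word_length :: "('a, 'b) monoid_scheme \<Rightarrow> 'a set \<Rightarrow> 'a \<Rightarrow> nat" where
  "word_length G A g =
     (LEAST n. \<exists>w. set w \<subseteq> A \<and> length w = n \<and> foldr (\<otimes>\<^bsub>G\<^esub>) w \<one>\<^bsub>G\<^esub> = g)"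

definition word_dist :: "('a, 'b) monoid_scheme \<Rightarrow> 'a set \<Rightarrow> 'a \<Rightarrow> 'a \<Rightarrow> real" where
  "word_dist G A g h = real (word_length G A (inv\<^bsub>G\<^esub> g \<otimes>\<^bsub>G\<^esub> h))"

definition gromov_product :: "('a, 'b) monoid_scheme \<Rightarrow> 'a set \<Rightarrow> 'a \<Rightarrow> 'a \<Rightarrow> 'a \<Rightarrow> real" where
  "gromov_product G A w x y = (word_dist G A x w + word_dist G A y w - word_dist G A x y) / 2"

definition hyperbolic_group :: "('a, 'b) monoid_scheme \<Rightarrow> 'a set \<Rightarrow> bool" where
  "hyperbolic_group G A \<longleftrightarrow>
     group G \<and> finite_symmetric_generating_set G A \<and>
     (\<exists>\<delta>\<ge>0. \<forall>w\<in>carrier G. \<forall>x\<in>carrier G. \<forall>y\<in>carrier G. \<forall>z\<in>carrier G.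
        gromov_product G A w x z \<ge> min (gromov_product G A w x y) (gromov_product G A w y z) - \<delta>)"

text \<open>
  A geodesic segment of the Cayley graph whose endpoints are vertices is an edge path of minimal
  length; it is represented by the list of its vertices.
\<close>

definition geodesic_path :: "('a, 'b) monoid_scheme \<Rightarrow> 'a set \<Rightarrow> 'a list \<Rightarrow> bool" where
  "geodesic_path G A p \<longleftrightarrow>
     p \<noteq> [] \<and> set p \<subseteq> carrier G \<and>
     (\<forall>i. Suc i < length p \<longrightarrow> (\<exists>a\<in>A. p ! Suc i = p ! i \<otimes>\<^bsub>G\<^esub> a)) \<and>
     real (length p - 1) = word_dist G A (hd p) (last p)"

text \<open>
  Distance, in the geometric realization of the Cayley graph (edges of length 1), from the point
  at distance \<open>t\<close> from \<open>g\<close> on the edge joining \<open>g\<close> to \<open>h\<close> to the vertex \<open>v\<close>.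
\<close>

definition edge_point_dist ::
  "('a, 'b) monoid_scheme \<Rightarrow> 'a set \<Rightarrow> 'a \<Rightarrow> 'a \<Rightarrow> real \<Rightarrow> 'a \<Rightarrow> real" where
  "edge_point_dist G A g h t v = min (t + word_dist G A g v) (1 - t + word_dist G A h v)"

text \<open>
  Below, \<open>i\<close> and \<open>t\<close> run over all points of the segment \<open>p\<close>. A segment of length 0
  consists of a point of \<open>Y\<close> and imposes no condition.
\<close>

definition quasiconvex :: "('a, 'b) monoid_scheme \<Rightarrow> 'a set \<Rightarrow> 'a set \<Rightarrow> bool" where
  "quasiconvex G A Y \<longleftrightarrow>
     Y \<subseteq> carrier G \<and>
     (\<exists>\<eta>\<ge>0. \<forall>p. geodesic_path G A p \<and> hd p \<in> Y \<and> last p \<in> Y \<longrightarrow>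
        (\<forall>i t. Suc i < length p \<and> 0 \<le> t \<and> t \<le> 1 \<longrightarrow>
           (\<exists>y\<in>Y. edge_point_dist G A (p ! i) (p ! Suc i) t y \<le> \<eta>)))"

definition elementary_group :: "('a, 'b) monoid_scheme \<Rightarrow> bool" where
  "elementary_group K \<longleftrightarrow>
     (\<exists>C. subgroup C K \<and> cyclic_group (K\<lparr>carrier := C\<rparr>) \<and> finite (rcosets\<^bsub>K\<^esub> C))"

end

theory Submission
  imports Defs
begin

text \<open>
  An element \<open>h\<close> lies in \<open>P\<^sub>1 Q\<^sup>-\<^sup>1 Q P\<^sub>2\<close> for some bounded \<open>P\<^sub>1\<close>, \<open>P\<^sub>2\<close> iff the geodesic from \<open>1\<close> to
  \<open>h\<close> runs close to a translate of the quasiconvex set \<open>Q\<close>; this passes to initial and final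
  segments. Both sets \<open>T\<^sup>-\<^sup>1 T\<close> are contained in a product of three such difference sets (for
  \<open>S\<close>, \<open>Q\<close>, \<open>S\<close>), so it suffices that the non-elementary subgroup \<open>H\<close> escapes \<open>W V\<close> when
  it escapes \<open>W\<close> and \<open>V\<close>. Given \<open>x\<close>, \<open>y\<close> in \<open>H\<close> escaping \<open>W\<close> and \<open>V\<close>, one joins them to
  \<open>x f y\<close> without backtracking, with \<open>f\<close> in a fixed finite subset of \<open>H\<close>. Such a finite subset
  exists, since otherwise large finite parts of \<open>H\<close> almost fix a point at infinity; the Busemann
  function there is almost a homomorphism on them with sublevel sets of bounded cardinality, which makes
  \<open>H\<close> elementary.
\<close>

section \<open>Word metrics\<close>

lemma (in group) inv_mult_cancel:
  assumes "x \<in> carrier G" "y \<in> carrier G"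
  shows "inv x \<otimes> (x \<otimes> y) = y" "x \<otimes> (inv x \<otimes> y) = y"
  using assms by (simp_all add: m_assoc[symmetric])

lemma (in group) foldr_mult_append:
  assumes "set u \<subseteq> carrier G" "set v \<subseteq> carrier G"
  shows "foldr (\<otimes>) (u @ v) \<one> = foldr (\<otimes>) u \<one> \<otimes> foldr (\<otimes>) v \<one>"
    and "foldr (\<otimes>) u \<one> \<in> carrier G"
proof -
  have closed: "foldr (\<otimes>) w \<one> \<in> carrier G" if "set w \<subseteq> carrier G" for w
    using that by (induction w) auto
  then show "foldr (\<otimes>) u \<one> \<in> carrier G" using assms by simp
  show "foldr (\<otimes>) (u @ v) \<one> = foldr (\<otimes>) u \<one> \<otimes> foldr (\<otimes>) v \<one>"
    using assms by (induction u) (auto simp: closed m_assoc)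
qed

lemma (in group) foldr_mult_inv:
  assumes "set w \<subseteq> carrier G"
  shows "foldr (\<otimes>) (rev (map (m_inv G) w)) \<one> = inv (foldr (\<otimes>) w \<one>)"
  using assms
proof (induction w)
  case (Cons a w)
  have "foldr (\<otimes>) (rev (map (m_inv G) (a # w))) \<one>
      = foldr (\<otimes>) (rev (map (m_inv G) w)) \<one> \<otimes> foldr (\<otimes>) [inv a] \<one>"
    using Cons.prems by (subst foldr_mult_append(1)[symmetric]) auto
  then show ?case
    using Cons foldr_mult_append(2)[of w "[]"] by (simp add: inv_mult_group)
qed simp

locale word_metric = group G for G :: "('a, 'b) monoid_scheme" (structure) +
  fixes A :: "'a set"
  assumes fsgs: "finite_symmetric_generating_set G A"
begin

abbreviation d :: "'a \<Rightarrow> 'a \<Rightarrow> real" where "d \<equiv> word_dist G A"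

abbreviation len :: "'a \<Rightarrow> real" where "len g \<equiv> d \<one> g"

definition ball :: "real \<Rightarrow> 'a set" where
  "ball r = {g \<in> carrier G. len g \<le> r}"

text \<open>The condition says that the Gromov product of \<open>a\<close> and \<open>b\<close> at
  \<open>x\<close> is at most \<open>e / 2\<close>. It stands for nearness of \<open>x\<close> to a
  geodesic from \<open>a\<close> to \<open>b\<close>, with an additive error that can be tracked
  without choosing a geodesic.\<close>

definition almost_between :: "real \<Rightarrow> 'a \<Rightarrow> 'a \<Rightarrow> 'a \<Rightarrow> bool" where
  "almost_between e a x b \<longleftrightarrow> d a x + d x b \<le> d a b + e"

lemma A_carrier: "A \<subseteq> carrier G" and finite_A: "finite A"
  and generate_A: "generate G A = carrier G"
  and inv_A: "a \<in> A \<Longrightarrow> inv a \<in> A"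
  using fsgs by (auto simp: finite_symmetric_generating_set_def SET_INV_def)

lemma word_length_le:
  "set w \<subseteq> A \<Longrightarrow> word_length G A (foldr (\<otimes>) w \<one>) \<le> length w"
  unfolding word_length_def by (rule Least_le) auto

lemma ex_min_word:
  assumes "g \<in> carrier G"
  shows "\<exists>w. set w \<subseteq> A \<and> length w = word_length G A g \<and> foldr (\<otimes>) w \<one> = g"
proof -
  have "\<exists>w. set w \<subseteq> A \<and> foldr (\<otimes>) w \<one> = g"
    using assms[folded generate_A]
  proof induction
    case one
    then show ?case by (rule exI[of _ "[]"]) simp
  next
    case (incl h)
    then show ?case using A_carrier by (intro exI[of _ "[h]"]) auto
  next
    case (inv h)
    then show ?case using A_carrier inv_A by (intro exI[of _ "[inv h]"]) auto
  next
    case (eng h1 h2)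
    then obtain u v where "set u \<subseteq> A" "foldr (\<otimes>) u \<one> = h1" "set v \<subseteq> A" "foldr (\<otimes>) v \<one> = h2"
      by blast
    then show ?case using A_carrier foldr_mult_append(1)[of u v]
      by (intro exI[of _ "u @ v"]) auto
  qed
  then have "\<exists>n w. set w \<subseteq> A \<and> length w = n \<and> foldr (\<otimes>) w \<one> = g" by blast
  then show ?thesis unfolding word_length_def by (rule LeastI_ex)
qed

lemma d_nonneg [simp]: "0 \<le> d x y"
  by (simp add: word_dist_def)

lemma len_eq: "g \<in> carrier G \<Longrightarrow> len g = word_length G A g"
  by (simp add: word_dist_def)

lemma d_eq_len: "\<lbrakk>x \<in> carrier G; y \<in> carrier G\<rbrakk> \<Longrightarrow> d x y = len (inv x \<otimes> y)"
  by (simp add: word_dist_def)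

lemma d_refl [simp]: "x \<in> carrier G \<Longrightarrow> d x x = 0"
  using word_length_le[of "[]"] by (simp add: word_dist_def)

lemma d_left_mult [simp]:
  "\<lbrakk>g \<in> carrier G; x \<in> carrier G; y \<in> carrier G\<rbrakk> \<Longrightarrow> d (g \<otimes> x) (g \<otimes> y) = d x y"
  by (simp add: word_dist_def inv_mult_group m_assoc inv_mult_cancel)

lemma len_mult_le:
  assumes "x \<in> carrier G" "y \<in> carrier G"
  shows "len (x \<otimes> y) \<le> len x + len y"
proof -
  obtain u v where u: "set u \<subseteq> A" "length u = word_length G A x" "foldr (\<otimes>) u \<one> = x"
    and v: "set v \<subseteq> A" "length v = word_length G A y" "foldr (\<otimes>) v \<one> = y"
    using ex_min_word assms by meson
  then have "foldr (\<otimes>) (u @ v) \<one> = x \<otimes> y"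
    using A_carrier foldr_mult_append(1)[of u v] by auto
  then show ?thesis
    using word_length_le[of "u @ v"] u v assms by (simp add: len_eq)
qed

lemma len_inv [simp]:
  assumes "x \<in> carrier G"
  shows "len (inv x) = len x"
proof -
  have le: "word_length G A (inv x) \<le> word_length G A x" if "x \<in> carrier G" for x
  proof -
    obtain u where u: "set u \<subseteq> A" "length u = word_length G A x" "foldr (\<otimes>) u \<one> = x"
      using ex_min_word \<open>x \<in> carrier G\<close> by meson
    have "foldr (\<otimes>) (rev (map (m_inv G) u)) \<one> = inv x"
      using foldr_mult_inv[of u] u A_carrier by auto
    then show ?thesis
      using word_length_le[of "rev (map (m_inv G) u)"] u inv_A by auto
  qed
  show ?thesis
    using le[OF assms] le[of "inv x"] assms by (simp add: len_eq)
qed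

lemma d_sym: "\<lbrakk>x \<in> carrier G; y \<in> carrier G\<rbrakk> \<Longrightarrow> d x y = d y x"
  using len_inv[of "inv x \<otimes> y"] by (simp add: d_eq_len[of x y] d_eq_len[of y x] inv_mult_group)

lemma d_triangle:
  assumes "x \<in> carrier G" "y \<in> carrier G" "z \<in> carrier G"
  shows "d x z \<le> d x y + d y z"
proof -
  have "inv x \<otimes> z = (inv x \<otimes> y) \<otimes> (inv y \<otimes> z)"
    using assms by (simp add: m_assoc inv_mult_cancel)
  then show ?thesis
    using len_mult_le[of "inv x \<otimes> y" "inv y \<otimes> z"] assms by (simp add: d_eq_len[of x] d_eq_len[of y])
qed

lemma d_mult_right:
  "\<lbrakk>x \<in> carrier G; y \<in> carrier G\<rbrakk> \<Longrightarrow> d x (x \<otimes> y) = len y"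
  by (simp add: d_eq_len[of x] inv_mult_cancel)

lemma d_inv_mult:
  assumes "g \<in> carrier G" "x \<in> carrier G" "y \<in> carrier G"
  shows "d (inv g \<otimes> x) y = d x (g \<otimes> y)"
  using d_left_mult[of g "inv g \<otimes> x" y] assms by (simp add: inv_mult_cancel)

lemma ball_carrier: "ball r \<subseteq> carrier G"
  by (auto simp: ball_def)

lemma ball_mono: "r \<le> s \<Longrightarrow> ball r \<subseteq> ball s"
  by (auto simp: ball_def)

lemma finite_ball: "finite (ball r)"
proof -
  let ?W = "{w. set w \<subseteq> A \<and> length w \<le> nat \<lfloor>r\<rfloor>}"
  have "ball r \<subseteq> (\<lambda>w. foldr (\<otimes>) w \<one>) ` ?W"
  proof
    fix g assume g: "g \<in> ball r"
    then obtain w where w: "set w \<subseteq> A" "length w = word_length G A g" "foldr (\<otimes>) w \<one> = g"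
      using ex_min_word ball_carrier by (meson subsetD)
    then have "real (length w) \<le> r" using g by (auto simp: ball_def len_eq)
    then have "length w \<le> nat \<lfloor>r\<rfloor>" by (simp add: le_nat_floor)
    then show "g \<in> (\<lambda>w. foldr (\<otimes>) w \<one>) ` ?W" using w by force
  qed
  moreover have "finite ?W" using finite_lists_length_le[OF finite_A] .
  ultimately show ?thesis by (meson finite_surj)
qed

lemma finite_subset_ball:
  assumes "finite P" "P \<subseteq> carrier G"
  shows "\<exists>r\<ge>0. P \<subseteq> ball r"
proof -
  have "len x \<le> sum len P" if "x \<in> P" for x
    using member_le_sum[of x P len] that assms(1) by simp
  then show ?thesis
    using assms by (intro exI[of _ "sum len P"]) (auto simp: ball_def sum_nonneg)
qed

lemma ex_geodesic_path:
  assumes "x \<in> carrier G" "y \<in> carrier G"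
  shows "\<exists>p. geodesic_path G A p \<and> hd p = x \<and> last p = y"
proof -
  obtain w where w: "set w \<subseteq> A" "length w = word_length G A (inv x \<otimes> y)"
    "foldr (\<otimes>) w \<one> = inv x \<otimes> y"
    using ex_min_word[of "inv x \<otimes> y"] assms by auto
  have wc: "set w \<subseteq> carrier G" using w A_carrier by blast
  define f where "f i = x \<otimes> foldr (\<otimes>) (take i w) \<one>" for i
  have fc: "f i \<in> carrier G" for i
    unfolding f_def using foldr_mult_append(2)[of "take i w" "[]"] wc assms(1) set_take_subset[of i w]
    by auto
  define p where "p = map f [0..<Suc (length w)]"
  have step: "f (Suc i) = f i \<otimes> w ! i" if "i < length w" for i
  proof -
    have "w ! i \<in> carrier G" using that wc nth_mem by blast
    then show ?thesis
      using foldr_mult_append[of "take i w" "[w ! i]"] that wc assms(1) set_take_subset[of i w]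
      unfolding f_def take_Suc_conv_app_nth[OF that] by (auto simp: m_assoc)
  qed
  have hd: "hd p = x"
    using assms by (simp add: p_def f_def hd_map del: upt_Suc)
  have last: "last p = y"
    using assms w by (simp add: p_def f_def last_map inv_mult_cancel)
  have "geodesic_path G A p"
    unfolding geodesic_path_def
  proof (intro conjI allI impI)
    show "set p \<subseteq> carrier G" using fc by (auto simp: p_def)
    show "\<exists>a\<in>A. p ! Suc i = p ! i \<otimes> a" if "Suc i < length p" for i
    proof -
      have i: "i < length w" using that by (simp add: p_def)
      then have "p ! Suc i = p ! i \<otimes> w ! i"
        using step unfolding p_def by (simp add: nth_map del: upt_Suc)
      then show ?thesis using i w nth_mem by blast
    qed
    show "real (length p - 1) = d (hd p) (last p)"
      unfolding hd last using w by (simp add: p_def word_dist_def)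
  qed (simp add: p_def)
  then show ?thesis using hd last by blast
qed

text \<open>Each edge moves by at most 1, so both distances are at most the numbers of edges used.
  Their sum is at least the total length, which forces equality in both.\<close>

lemma geodesic_path_dist:
  assumes p: "geodesic_path G A p" and i: "i < length p"
  shows "d (hd p) (p ! i) = i" and "d (p ! i) (last p) = real (length p - 1 - i)"
proof -
  have pc: "p ! j \<in> carrier G" if "j < length p" for j
    using p that nth_mem by (auto simp: geodesic_path_def)
  have ne: "p \<noteq> []" and tot: "real (length p - 1) = d (hd p) (last p)"
    using p by (auto simp: geodesic_path_def)
  have le: "d (p ! j) (p ! (j + k)) \<le> k" if "j + k < length p" for j k
    using that
  proof (induction k)
    case (Suc k)
    obtain a where a: "a \<in> A" "p ! Suc (j + k) = p ! (j + k) \<otimes> a"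
      using p Suc.prems by (auto simp: geodesic_path_def)
    have "len a \<le> 1"
      using a A_carrier word_length_le[of "[a]"] len_eq[of a] by auto
    then have "d (p ! (j + k)) (p ! Suc (j + k)) \<le> 1"
      using a A_carrier d_mult_right[of "p ! (j + k)" a] pc[of "j + k"] Suc.prems by auto
    then show ?case
      using Suc d_triangle[of "p ! j" "p ! (j + k)" "p ! Suc (j + k)"] pc by fastforce
  qed (use pc in auto)
  have hd: "hd p = p ! 0" and last: "last p = p ! (length p - 1)"
    using ne by (simp_all add: hd_conv_nth last_conv_nth)
  have 1: "d (hd p) (p ! i) \<le> i"
    using le[of 0 i] i hd by simp
  have 2: "d (p ! i) (last p) \<le> real (length p - 1 - i)"
    using le[of i "length p - 1 - i"] i last by simp
  have "d (hd p) (last p) \<le> d (hd p) (p ! i) + d (p ! i) (last p)"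
    using d_triangle pc i ne hd last by simp
  then show "d (hd p) (p ! i) = i" "d (p ! i) (last p) = real (length p - 1 - i)"
    using 1 2 tot i by (auto simp: of_nat_diff)
qed

lemma almost_between_left_mult:
  assumes "g \<in> carrier G" "a \<in> carrier G" "x \<in> carrier G" "b \<in> carrier G"
  shows "almost_between e (g \<otimes> a) (g \<otimes> x) (g \<otimes> b) \<longleftrightarrow> almost_between e a x b"
  using assms by (simp add: almost_between_def)

lemma almost_between_mono: "\<lbrakk>almost_between e a x b; e \<le> e'\<rbrakk> \<Longrightarrow> almost_between e' a x b"
  by (simp add: almost_between_def)

lemma almost_between_perturb:
  assumes "almost_between e a x b"
    and "a \<in> carrier G" "x \<in> carrier G" "b \<in> carrier G" "a' \<in> carrier G" "b' \<in> carrier G"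
  shows "almost_between (e + 2 * d a a' + 2 * d b b') a' x b'"
  using assms d_triangle[of a' a x] d_triangle[of x b b'] d_triangle[of a a' b] d_triangle[of a' b' b]
    d_sym[of a a'] d_sym[of b b']
  unfolding almost_between_def by simp

end

section \<open>Hyperbolicity as an inequality between distances\<close>

locale hyperbolic_word_metric = word_metric +
  fixes \<delta> :: real
  assumes delta_nonneg: "0 \<le> \<delta>"
    and gromov: "\<lbrakk>w \<in> carrier G; x \<in> carrier G; y \<in> carrier G; z \<in> carrier G\<rbrakk> \<Longrightarrow>
      gromov_product G A w x z \<ge> min (gromov_product G A w x y) (gromov_product G A w y z) - \<delta>"
begin

text \<open>Doubling the Gromov inequality at base point \<open>e\<close> and cancelling distances
  to \<open>e\<close> gives this form, which compares the three pairings of four points.\<close>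

lemma four_point:
  assumes "a \<in> carrier G" "b \<in> carrier G" "c \<in> carrier G" "e \<in> carrier G"
  shows "d a b + d c e \<le> max (d a c + d b e) (d a e + d b c) + 2 * \<delta>"
  using gromov[of e a c b] assms d_sym[of a b] d_sym[of b c]
  unfolding gromov_product_def by (auto simp: min_def max_def field_simps split: if_splits)

text \<open>In the four point inequality for \<open>x\<close>, \<open>c\<close> against
  \<open>a\<close>, \<open>b\<close>, the larger of the two sums decides which side of the triangle
  \<open>x\<close> follows. This is thinness of triangles, at a cost of \<open>2 * \<delta>\<close>
  per cut.\<close>

lemma almost_between_split:
  assumes "almost_between e a x b"
    and "a \<in> carrier G" "x \<in> carrier G" "b \<in> carrier G" "c \<in> carrier G"
  shows "almost_between (e + 2 * \<delta>) a x c \<or> almost_between (e + 2 * \<delta>) c x b"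
  using assms four_point[of x c a b] d_sym[of x a] d_sym[of a c] d_sym[of x c]
  unfolding almost_between_def by (auto simp: max_def split: if_splits)


section \<open>Quasiconvex subsets\<close>

text \<open>Quantifying over every tolerance \<open>e\<close> keeps the notion stable under cutting
  and perturbing, both of which enlarge the tolerance.\<close>

definition coarsely_convex :: "'a set \<Rightarrow> bool" where
  "coarsely_convex Y \<longleftrightarrow> Y \<subseteq> carrier G \<and>
     (\<forall>e. \<exists>C\<ge>0. \<forall>a\<in>Y. \<forall>b\<in>Y. \<forall>x\<in>carrier G. almost_between e a x b \<longrightarrow> (\<exists>y\<in>Y. d x y \<le> C))"

lemma coarsely_convexD:
  assumes "coarsely_convex Y"
  obtains C where "0 \<le> C"
    "\<And>a b x. \<lbrakk>a \<in> Y; b \<in> Y; x \<in> carrier G; almost_between e a x b\<rbrakk> \<Longrightarrow> \<exists>y\<in>Y. d x y \<le> C"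
  using assms unfolding coarsely_convex_def by metis

lemma ex_near_geodesic_point:
  assumes p: "geodesic_path G A p" and x: "x \<in> carrier G"
    and e: "0 \<le> e" "almost_between e (hd p) x (last p)"
  shows "\<exists>i<length p. d x (p ! i) \<le> e + 1 + 2 * \<delta>"
proof -
  define a b where "a = hd p" and "b = last p"
  have ne: "p \<noteq> []" and len: "real (length p - 1) = d a b" and pc: "set p \<subseteq> carrier G"
    using p by (auto simp: geodesic_path_def a_def b_def)
  have ab: "a \<in> carrier G" "b \<in> carrier G"
    using ne pc by (auto simp: a_def b_def)
  \<comment> \<open>The vertex as far from \<open>a\<close> as \<open>x\<close> is, rounded down to
    an integer and cut off at the end of the path, since \<open>d a x\<close> may exceed
    \<open>d a b\<close>.\<close>
  define i where "i = min (length p - 1) (nat \<lfloor>d a x\<rfloor>)"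
  have fl: "real (nat \<lfloor>d a x\<rfloor>) \<le> d a x" "d a x \<le> real (nat \<lfloor>d a x\<rfloor>) + 1"
    by auto
  have i: "i < length p" using ne by (cases p) (auto simp: i_def)
  then have q: "p ! i \<in> carrier G" using pc by auto
  have dist: "d a (p ! i) = i" "d (p ! i) b = d a b - i"
    using geodesic_path_dist[OF p i] len i unfolding a_def b_def by (auto simp: of_nat_diff)
  have "real i = min (d a b) (real (nat \<lfloor>d a x\<rfloor>))"
    unfolding i_def len[symmetric] by (simp only: of_nat_min)
  then have bounds: "real i \<le> d a x" "d a x - 1 - e \<le> real i"
    using fl e d_nonneg[of x b] unfolding almost_between_def a_def[symmetric] b_def[symmetric]
    by linarith+
  have "d x (p ! i) + d a b \<le> max (d x a + d (p ! i) b) (d x b + d (p ! i) a) + 2 * \<delta>"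
    using four_point[of x "p ! i" a b] x q ab by simp
  moreover have "d x a = d a x" "d (p ! i) a = d a (p ! i)"
    using d_sym x q ab by auto
  ultimately have "d x (p ! i) \<le> e + 1 + 2 * \<delta>"
    using e bounds dist unfolding almost_between_def a_def[symmetric] b_def[symmetric]
    by (auto simp: max_def split: if_splits)
  then show ?thesis using i by blast
qed

text \<open>Forward, a point almost between two elements of \<open>Y\<close> is near a vertex of a
  geodesic joining them, and this vertex is near \<open>Y\<close>. Backward, vertices of a geodesic
  are between its ends with tolerance 0, and a point of an edge is within 1 of the initial
  vertex.\<close>

lemma quasiconvex_iff_coarsely_convex: "quasiconvex G A Y \<longleftrightarrow> coarsely_convex Y"
proof
  assume qc: "quasiconvex G A Y"
  then obtain \<eta> where Y: "Y \<subseteq> carrier G" and eta: "0 \<le> \<eta>"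
    "\<And>p i t. \<lbrakk>geodesic_path G A p; hd p \<in> Y; last p \<in> Y; Suc i < length p; 0 \<le> t; t \<le> 1\<rbrakk>
      \<Longrightarrow> \<exists>y\<in>Y. edge_point_dist G A (p ! i) (p ! Suc i) t y \<le> \<eta>"
    unfolding quasiconvex_def by metis
  have near: "\<exists>y\<in>Y. d (p ! i) y \<le> \<eta> + 1"
    if p: "geodesic_path G A p" "hd p \<in> Y" "last p \<in> Y" and i: "i < length p" for p i
  proof (cases "Suc i < length p")
    case True
    then obtain y where y: "y \<in> Y" "edge_point_dist G A (p ! i) (p ! Suc i) 0 y \<le> \<eta>"
      using eta(2)[OF p True, of 0] by auto
    have pc: "set p \<subseteq> carrier G" using p by (simp add: geodesic_path_def)
    then have c: "p ! i \<in> carrier G" "p ! Suc i \<in> carrier G" "y \<in> carrier G"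
      using True i y Y by (auto intro: nth_mem)
    obtain a where a: "a \<in> A" "p ! Suc i = p ! i \<otimes> a"
      using p True by (auto simp: geodesic_path_def)
    have "d (p ! i) (p ! Suc i) \<le> 1"
      using a A_carrier word_length_le[of "[a]"] len_eq[of a] d_mult_right[of "p ! i" a] c by auto
    then show ?thesis
      using y d_triangle[OF c] unfolding edge_point_dist_def
      by (intro bexI[of _ y]) (auto simp: min_def split: if_splits)
  next
    case False
    \<comment> \<open>The last vertex starts no edge, but it belongs to \<open>Y\<close>.\<close>
    have ne: "p \<noteq> []" using p by (simp add: geodesic_path_def)
    then have "p ! i = last p" using False i by (metis Suc_lessI diff_Suc_1 last_conv_nth)
    then show ?thesis using p Y eta(1) by (intro bexI[of _ "last p"]) auto
  qed
  show "coarsely_convex Y"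
    unfolding coarsely_convex_def
  proof (intro conjI allI exI ballI impI)
    fix e a b x
    assume a: "a \<in> Y" and b: "b \<in> Y" and x: "x \<in> carrier G" and e: "almost_between e a x b"
    obtain p where p: "geodesic_path G A p" "hd p = a" "last p = b"
      using ex_geodesic_path a b Y by (meson subsetD)
    have "almost_between \<bar>e\<bar> a x b" using e by (rule almost_between_mono) simp
    then obtain i where i: "i < length p" "d x (p ! i) \<le> \<bar>e\<bar> + 1 + 2 * \<delta>"
      using ex_near_geodesic_point[of p x "\<bar>e\<bar>"] p x by auto
    obtain y where y: "y \<in> Y" "d (p ! i) y \<le> \<eta> + 1"
      using near[of p i] p i a b by auto
    have "p ! i \<in> carrier G" using p i nth_mem by (auto simp: geodesic_path_def)
    then show "\<exists>y\<in>Y. d x y \<le> \<bar>e\<bar> + 2 + 2 * \<delta> + \<eta>"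
      using d_triangle[of x "p ! i" y] x y i Y by (intro bexI[of _ y]) auto
  qed (use Y delta_nonneg eta(1) in auto)
next
  assume cc: "coarsely_convex Y"
  then have Y: "Y \<subseteq> carrier G" by (simp add: coarsely_convex_def)
  obtain C where C: "0 \<le> C"
    "\<And>a b x. \<lbrakk>a \<in> Y; b \<in> Y; x \<in> carrier G; almost_between 0 a x b\<rbrakk> \<Longrightarrow> \<exists>y\<in>Y. d x y \<le> C"
    using coarsely_convexD[OF cc, of 0] by blast
  show "quasiconvex G A Y"
    unfolding quasiconvex_def
  proof (intro conjI exI[of _ "C + 1"] allI impI; (elim conjE)?)
    fix p i and t :: real
    assume p: "geodesic_path G A p" "hd p \<in> Y" "last p \<in> Y"
      and i: "Suc i < length p" and t: "0 \<le> t" "t \<le> 1"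
    have "p ! i \<in> carrier G" using p i by (auto simp: geodesic_path_def)
    moreover have "almost_between 0 (hd p) (p ! i) (last p)"
      using geodesic_path_dist[OF p(1), of i] i p(1)
      by (auto simp: almost_between_def geodesic_path_def of_nat_diff)
    ultimately obtain y where "y \<in> Y" "d (p ! i) y \<le> C"
      using C(2) p by blast
    then show "\<exists>y\<in>Y. edge_point_dist G A (p ! i) (p ! Suc i) t y \<le> C + 1"
      using t by (intro bexI[of _ y]) (auto simp: edge_point_dist_def)
  qed (use Y C(1) in auto)
qed

text \<open>For ends in different sets, the segment is cut at a fixed \<open>q0\<close> in
  \<open>Q\<close>; the half from \<open>q0\<close> to a point of \<open>S\<close> is then moved to
  start at a fixed \<open>s0\<close> in \<open>S\<close>. The constant \<open>e'\<close> covers the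
  cut and the move.\<close>

lemma coarsely_convex_Un:
  assumes Q: "coarsely_convex Q" and S: "coarsely_convex S"
  shows "coarsely_convex (Q \<union> S)"
proof (cases "Q = {} \<or> S = {}")
  case True
  then show ?thesis using Q S by auto
next
  case False
  then obtain q0 s0 where q0: "q0 \<in> Q" and s0: "s0 \<in> S" by blast
  have QS: "Q \<subseteq> carrier G" "S \<subseteq> carrier G" using Q S by (auto simp: coarsely_convex_def)
  have c0: "q0 \<in> carrier G" "s0 \<in> carrier G" using q0 s0 QS by auto
  show ?thesis
    unfolding coarsely_convex_def
  proof (intro conjI allI)
    fix e
    define e' where "e' = e + 2 * \<delta> + 2 * d q0 s0"
    obtain C where C: "0 \<le> C"
      "\<And>a b x. \<lbrakk>a \<in> Q; b \<in> Q; x \<in> carrier G; almost_between e' a x b\<rbrakk> \<Longrightarrow> \<exists>y\<in>Q. d x y \<le> C"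
      using coarsely_convexD[OF Q, of e'] by blast
    obtain D where D: "0 \<le> D"
      "\<And>a b x. \<lbrakk>a \<in> S; b \<in> S; x \<in> carrier G; almost_between e' a x b\<rbrakk> \<Longrightarrow> \<exists>y\<in>S. d x y \<le> D"
      using coarsely_convexD[OF S, of e'] by blast
    have Q': "\<exists>y\<in>Q \<union> S. d x y \<le> max C D"
      if "a \<in> Q" "b \<in> Q" "x \<in> carrier G" "almost_between e' a x b" for a b x
      using C(2)[OF that] by (auto simp: le_max_iff_disj)
    have S': "\<exists>y\<in>Q \<union> S. d x y \<le> max C D"
      if "a \<in> S" "b \<in> S" "x \<in> carrier G" "almost_between e' a x b" for a b x
      using D(2)[OF that] by (auto simp: le_max_iff_disj)
    have le: "e \<le> e'" "e + 2 * \<delta> \<le> e'" using delta_nonneg by (auto simp: e'_def)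
    have mixed: "\<exists>y\<in>Q \<union> S. d x y \<le> max C D"
      if ab: "a \<in> Q" "b \<in> S" and x: "x \<in> carrier G" and btw: "almost_between e a x b" for a b x
    proof -
      have c: "a \<in> carrier G" "b \<in> carrier G" using ab QS by auto
      consider "almost_between (e + 2 * \<delta>) a x q0" | "almost_between (e + 2 * \<delta>) q0 x b"
        using almost_between_split[OF btw c(1) x c(2) c0(1)] by blast
      then show ?thesis
      proof cases
        case 1
        then have "almost_between e' a x q0" using le(2) by (rule almost_between_mono)
        then show ?thesis using Q' ab q0 x by simp
      next
        case 2
        have "almost_between e' s0 x b"
          using almost_between_perturb[OF 2 c0(1) x c(2) c0(2) c(2)] c by (simp add: e'_def)
        then show ?thesis using S' ab s0 x by simp
      qed
    qed
    have swap: "almost_between e b x a" if "almost_between e a x b" "a \<in> Q \<union> S" "b \<in> Q \<union> S" "x \<in> carrier G"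
      for a b x
    proof -
      have "a \<in> carrier G" "b \<in> carrier G" using that QS by auto
      then show ?thesis using that d_sym[of a x] d_sym[of x b] d_sym[of a b]
        unfolding almost_between_def by simp
    qed
    show "\<exists>C\<ge>0. \<forall>a\<in>Q \<union> S. \<forall>b\<in>Q \<union> S. \<forall>x\<in>carrier G.
        almost_between e a x b \<longrightarrow> (\<exists>y\<in>Q \<union> S. d x y \<le> C)"
    proof (intro exI[of _ "max C D"] conjI ballI impI)
      fix a b x
      assume ab: "a \<in> Q \<union> S" "b \<in> Q \<union> S" and x: "x \<in> carrier G"
        and btw: "almost_between e a x b"
      have btw': "almost_between e' a x b" using btw le(1) by (rule almost_between_mono)
      consider "a \<in> Q" "b \<in> Q" | "a \<in> S" "b \<in> S" | "a \<in> Q" "b \<in> S" | "b \<in> Q" "a \<in> S"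
        using ab by blast
      then show "\<exists>y\<in>Q \<union> S. d x y \<le> max C D"
      proof cases
        case 1
        then show ?thesis using Q' x btw' by simp
      next
        case 2
        then show ?thesis using S' x btw' by simp
      next
        case 3
        then show ?thesis using mixed x btw by simp
      next
        case 4
        then show ?thesis using mixed x swap[OF btw ab x] by simp
      qed
    qed (use C D in auto)
  qed (use QS in auto)
qed

text \<open>The ends \<open>q \<otimes> s\<close> and \<open>q' \<otimes> s'\<close> are joined
  through \<open>q\<close> and \<open>q'\<close>, and two cuts place the point along one of three
  sides. The outer sides are translates of segments from \<open>\<one>\<close> to points of
  \<open>S\<close>; the middle one joins points of \<open>Q\<close>.\<close>

lemma coarsely_convex_set_mult:
  assumes Q: "coarsely_convex Q" and S: "coarsely_convex S"
  shows "coarsely_convex (Q <#> S)"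
proof (cases "S = {}")
  case True
  then show ?thesis by (auto simp: coarsely_convex_def set_mult_def)
next
  case False
  then obtain s0 where s0: "s0 \<in> S" by blast
  have QS: "Q \<subseteq> carrier G" "S \<subseteq> carrier G" using Q S by (auto simp: coarsely_convex_def)
  have s0c: "s0 \<in> carrier G" using s0 QS by auto
  show ?thesis
    unfolding coarsely_convex_def
  proof (intro conjI allI)
    show "Q <#> S \<subseteq> carrier G" using set_mult_closed QS by blast
    fix e
    \<comment> \<open>Two cuts cost \<open>4 * \<delta>\<close>; replacing the endpoint
      \<open>\<one>\<close> by the element \<open>s0\<close> of \<open>S\<close> costs
      \<open>2 * len s0\<close>.\<close>
    define e' where "e' = e + 4 * \<delta> + 2 * len s0"
    obtain C where C: "0 \<le> C"
      "\<And>a b x. \<lbrakk>a \<in> Q; b \<in> Q; x \<in> carrier G; almost_between e' a x b\<rbrakk> \<Longrightarrow> \<exists>y\<in>Q. d x y \<le> C"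
      using coarsely_convexD[OF Q, of e'] by blast
    obtain D where D: "0 \<le> D"
      "\<And>a b x. \<lbrakk>a \<in> S; b \<in> S; x \<in> carrier G; almost_between e' a x b\<rbrakk> \<Longrightarrow> \<exists>y\<in>S. d x y \<le> D"
      using coarsely_convexD[OF S, of e'] by blast
    define K where "K = max (C + len s0) D"
    have fibre: "\<exists>y\<in>Q <#> S. d x y \<le> K"
      if q: "q \<in> Q" and s: "s \<in> S" and x: "x \<in> carrier G"
        and btw: "almost_between (e + 4 * \<delta>) q x (q \<otimes> s)" for q s x
    proof -
      have c: "q \<in> carrier G" "s \<in> carrier G" using q s QS by auto
      have "almost_between (e + 4 * \<delta>) \<one> (inv q \<otimes> x) s"
        using btw almost_between_left_mult[of q \<one> "inv q \<otimes> x" s] c x by (simp add: inv_mult_cancel)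
      then have "almost_between e' s0 (inv q \<otimes> x) s"
        using almost_between_perturb[of "e + 4 * \<delta>" \<one> "inv q \<otimes> x" s s0 s] c x s0c
        by (simp add: e'_def)
      then obtain y where y: "y \<in> S" "d (inv q \<otimes> x) y \<le> D"
        using D(2) s0 s x c by (metis inv_closed m_closed)
      then have "d x (q \<otimes> y) \<le> D"
        using d_inv_mult[of q x y] c x QS by auto
      moreover have "q \<otimes> y \<in> Q <#> S" using q y by (auto simp: set_mult_def)
      ultimately show ?thesis unfolding K_def by (auto intro!: bexI[of _ "q \<otimes> y"])
    qed
    have base: "\<exists>y\<in>Q <#> S. d x y \<le> K"
      if q: "q \<in> Q" "q' \<in> Q" and x: "x \<in> carrier G"
        and btw: "almost_between (e + 4 * \<delta>) q x q'" for q q' x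
    proof -
      have "almost_between e' q x q'"
        using btw by (rule almost_between_mono) (simp add: e'_def)
      then obtain y where y: "y \<in> Q" "d x y \<le> C" using C(2) q x by blast
      then have "d x (y \<otimes> s0) \<le> C + len s0"
        using d_triangle[of x y "y \<otimes> s0"] d_mult_right[of y s0] x s0c QS by auto
      moreover have "y \<otimes> s0 \<in> Q <#> S" using y s0 by (auto simp: set_mult_def)
      ultimately show ?thesis unfolding K_def by (auto intro!: bexI[of _ "y \<otimes> s0"])
    qed
    show "\<exists>C\<ge>0. \<forall>a\<in>Q <#> S. \<forall>b\<in>Q <#> S. \<forall>x\<in>carrier G.
        almost_between e a x b \<longrightarrow> (\<exists>y\<in>Q <#> S. d x y \<le> C)"
    proof (intro exI[of _ K] conjI ballI impI)
      fix a b x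
      assume ab: "a \<in> Q <#> S" "b \<in> Q <#> S" and x: "x \<in> carrier G" and btw: "almost_between e a x b"
      obtain q s q' s' where a: "a = q \<otimes> s" "q \<in> Q" "s \<in> S" and b: "b = q' \<otimes> s'" "q' \<in> Q" "s' \<in> S"
        using ab by (auto simp: set_mult_def)
      have c: "q \<in> carrier G" "s \<in> carrier G" "q' \<in> carrier G" "s' \<in> carrier G"
        using a b QS by auto
      have c': "a \<in> carrier G" "b \<in> carrier G" using c a b by auto
      have "almost_between (e + 2 * \<delta>) a x q \<or> almost_between (e + 2 * \<delta>) q x b"
        using almost_between_split[OF btw] c c' x by blast
      moreover have "almost_between (e + 4 * \<delta>) q x q' \<or> almost_between (e + 4 * \<delta>) q' x b"
        if "almost_between (e + 2 * \<delta>) q x b"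
        using almost_between_split[OF that, of q'] c c' x by (simp add: ac_simps)
      moreover have "almost_between (e + 4 * \<delta>) q x a" if "almost_between (e + 2 * \<delta>) a x q"
        using that d_sym[of a x] d_sym[of x q] d_sym[of a q] c c' x delta_nonneg
        unfolding almost_between_def by simp
      ultimately consider "almost_between (e + 4 * \<delta>) q x (q \<otimes> s)"
        | "almost_between (e + 4 * \<delta>) q x q'" | "almost_between (e + 4 * \<delta>) q' x (q' \<otimes> s')"
        using a b by blast
      then show "\<exists>y\<in>Q <#> S. d x y \<le> K"
        using fibre[of q s x] base[of q q' x] fibre[of q' s' x] a b x by cases simp_all
    qed (use C D in \<open>auto simp: K_def\<close>)
  qed
qed

section \<open>Elements that almost fix a point at infinity\<close>

text \<open>
  For \<open>y\<close> far away, \<open>far_fixes \<rho> y g\<close> says that \<open>g\<close> moves \<open>y\<close> as if it fixed the point at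
  infinity in direction \<open>y\<close>, and \<open>busemann y\<close> plays the role of the Busemann function there.
\<close>

definition far_fixes :: "real \<Rightarrow> 'a \<Rightarrow> 'a \<Rightarrow> bool" where
  "far_fixes \<rho> y g \<longleftrightarrow> d y (g \<otimes> y) \<le> 2 * len y - \<rho>"

definition busemann :: "'a \<Rightarrow> 'a \<Rightarrow> real" where
  "busemann y g = d g y - len y"

lemma busemann_le_len:
  "\<lbrakk>y \<in> carrier G; g \<in> carrier G\<rbrakk> \<Longrightarrow> \<bar>busemann y g\<bar> \<le> len g"
  using d_triangle[of \<one> g y] d_triangle[of g \<one> y] d_sym[of \<one> g]
  by (simp add: busemann_def)

text \<open>Among the three pairings of four points, the two largest sums differ by at most
  \<open>2 * \<delta>\<close>. The hypotheses make the pairing of \<open>u\<close> with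
  \<open>v\<close> and \<open>y\<close> with \<open>z\<close> too small to be one of these
  two.\<close>

lemma exchange:
  assumes "u \<in> carrier G" "v \<in> carrier G" "y \<in> carrier G" "z \<in> carrier G"
    and "d u v + d y z + 2 * \<delta> < d u y + d v z" "d u v + d y z + 2 * \<delta> < d u z + d v y"
  shows "\<bar>d u y + d v z - d u z - d v y\<bar> \<le> 2 * \<delta>"
  using four_point[of u y v z] four_point[of u z v y] assms d_sym[of y v] d_sym[of z v] d_sym[of y z]
  by (auto simp: max_def split: if_splits)

text \<open>\<open>exchange\<close> is applied to \<open>f \<otimes> g\<close>, \<open>f\<close> and
  \<open>y\<close>, \<open>f \<otimes> y\<close>; cancelling \<open>f\<close> turns distances to
  \<open>f \<otimes> y\<close> into distances from \<open>g\<close> and \<open>\<one>\<close> to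
  \<open>y\<close>. The triangle inequalities lose at most \<open>3 * m\<close>, which
  \<open>\<rho>\<close> has to exceed together with \<open>2 * \<delta>\<close>.\<close>

lemma busemann_mult:
  assumes c: "f \<in> carrier G" "g \<in> carrier G" "y \<in> carrier G"
    and m: "len f \<le> m" "len g \<le> m" and far: "far_fixes \<rho> y f" and rho: "3 * m + 2 * \<delta> < \<rho>"
  shows "\<bar>busemann y (f \<otimes> g) - busemann y f - busemann y g\<bar> \<le> 2 * \<delta>"
proof -
  let ?u = "f \<otimes> g" and ?z = "f \<otimes> y"
  have uv: "d ?u f = len g"
    using d_mult_right[of f g] d_sym[of ?u f] c by simp
  have vz: "d f ?z = len y" and uz: "d ?u ?z = d g y"
    using d_mult_right c by auto
  have "len y \<le> len f + d f y" "len y \<le> len g + d g y" "len y \<le> len ?u + d ?u y"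
    using d_triangle[of \<one>] c by auto
  moreover have "len ?u \<le> len f + len g" using len_mult_le c by simp
  ultimately have "\<bar>d ?u y + d f ?z - d ?u ?z - d f y\<bar> \<le> 2 * \<delta>"
    using far m rho uv vz uz c unfolding far_fixes_def by (intro exchange) auto
  then show ?thesis
    unfolding busemann_def vz uz by simp
qed

text \<open>
  An element that almost fixes \<open>y\<close> at infinity without moving horoballs much barely moves a point
  \<open>p\<close> far along the geodesic from \<open>\<one>\<close> to \<open>y\<close>, so it lies in a conjugate of a fixed ball.
\<close>

lemma card_busemann_le:
  assumes y: "y \<in> carrier G" and U: "U \<subseteq> carrier G"
    and m: "\<And>f. f \<in> U \<Longrightarrow> len f \<le> real m" and far: "\<And>f. f \<in> U \<Longrightarrow> far_fixes \<rho> y f"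
    and rho: "3 * real m + 2 * \<delta> < \<rho>" "\<rho> \<le> 2 * len y"
    and small: "\<And>f. f \<in> U \<Longrightarrow> \<bar>busemann y f\<bar> \<le> K"
  shows "card U \<le> card (ball (K + 6 * \<delta>))"
proof -
  obtain p where p: "geodesic_path G A p" "hd p = \<one>" "last p = y"
    using ex_geodesic_path[OF one_closed y] by blast
  have len_p: "real (length p - 1) = len y" "p \<noteq> []" "set p \<subseteq> carrier G"
    using p by (auto simp: geodesic_path_def)
  have "real m \<le> len y" using rho delta_nonneg by simp
  then have "m \<le> length p - 1" using len_p by simp
  then have i: "m < length p" using len_p by (cases p) auto
  \<comment> \<open>The vertex at distance \<open>m\<close> from \<open>\<one>\<close> on the
    geodesic to \<open>y\<close>; the two bounds on \<open>\<rho>\<close> ensure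
    \<open>m \<le> len y\<close>.\<close>
  define c where "c = p ! m"
  have c: "c \<in> carrier G" using i len_p by (auto simp: c_def)
  have c1: "len c = m" and cy: "d c y = len y - m"
    using geodesic_path_dist[OF p(1) i] p len_p \<open>m \<le> length p - 1\<close> unfolding c_def
    by (simp_all add: of_nat_diff)
  have main: "d c (f \<otimes> c) \<le> K + 6 * \<delta>" if f: "f \<in> U" for f
  proof -
    have fc: "f \<in> carrier G" using f U by auto
    note fm = m[OF f] and ff = far[OF f, unfolded far_fixes_def] and fs = small[OF f]
    let ?fc = "f \<otimes> c" and ?fy = "f \<otimes> y"
    have inv_f: "d (inv f) y = len ?fy"
      using d_inv_mult[of f \<one> y] fc y by simp
    \<comment> \<open>As \<open>busemann y \<one> = 0\<close>, almost additivity bounds the value at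
      \<open>inv f\<close>.\<close>
    have "\<bar>busemann y (f \<otimes> inv f) - busemann y f - busemann y (inv f)\<bar> \<le> 2 * \<delta>"
      using busemann_mult[of f "inv f" y "real m" \<rho>] fc y fm far[OF f] rho by simp
    then have binv: "busemann y (inv f) \<le> K + 2 * \<delta>"
      using fs fc y by (simp add: busemann_def)
    \<comment> \<open>This bounds how much farther \<open>?fc\<close> is from \<open>y\<close> than
      \<open>c\<close> is; the next four point inequality does the same for the distance to
      \<open>\<one>\<close>.\<close>
    have "d ?fc y + d f ?fy \<le> max (d ?fc f + d y ?fy) (d ?fc ?fy + d y f) + 2 * \<delta>"
      using fc y c by (intro four_point) simp_all
    moreover have "d ?fc f = m" "d f ?fy = len y" "d ?fc ?fy = len y - m" "d y f = d f y"
      using d_mult_right[of f c] d_mult_right[of f y] d_sym[of ?fc f] d_sym[of y f] fc y c c1 cy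
      by auto
    ultimately have 1: "d ?fc y \<le> len y - m + K + 2 * \<delta>"
      using ff fs rho delta_nonneg unfolding busemann_def by (auto simp: max_def split: if_splits)
    have "d c (inv f) + d \<one> y \<le> max (d c \<one> + d (inv f) y) (d c y + d (inv f) \<one>) + 2 * \<delta>"
      using four_point[of c "inv f" \<one> y] fc y c by simp
    moreover have "d c (inv f) = len ?fc" "d c \<one> = m" "d (inv f) \<one> = len f"
      using d_inv_mult[of f \<one> c] d_sym[of c "inv f"] d_sym[of c \<one>] d_sym[of "inv f" \<one>] len_inv[of f]
        fc c c1 by auto
    ultimately have 2: "len ?fc \<le> m + K + 4 * \<delta>"
      using binv fm cy fs delta_nonneg unfolding busemann_def by (auto simp: max_def split: if_splits)
    \<comment> \<open>Since \<open>c\<close> lies on a geodesic from \<open>\<one>\<close> to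
      \<open>y\<close> and \<open>?fc\<close> is hardly farther from either end, the two points are
      close.\<close>
    have "d c ?fc + d \<one> y \<le> max (d c \<one> + d ?fc y) (d c y + d ?fc \<one>) + 2 * \<delta>"
      using four_point[of c ?fc \<one> y] fc y c by simp
    moreover have "d c \<one> = m" "d ?fc \<one> = len ?fc"
      using d_sym[of c \<one>] d_sym[of ?fc \<one>] c c1 fc by auto
    ultimately show ?thesis using 1 2 cy delta_nonneg by (auto simp: max_def split: if_splits)
  qed
  let ?\<phi> = "\<lambda>f. inv c \<otimes> (f \<otimes> c)"
  have "inj_on ?\<phi> U"
    using U c by (intro inj_onI) (auto simp: subset_eq)
  moreover have "?\<phi> ` U \<subseteq> ball (K + 6 * \<delta>)"
  proof (rule image_subsetI)
    fix f assume f: "f \<in> U"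
    then show "?\<phi> f \<in> ball (K + 6 * \<delta>)"
      using main[OF f] U c d_eq_len[of c "f \<otimes> c"] by (auto simp: ball_def)
  qed
  ultimately show ?thesis using card_inj_on_le finite_ball by blast
qed

text \<open>Division with remainder by \<open>k\<close>: each multiplication by \<open>k\<close> or
  \<open>inv k\<close> lowers the absolute value of \<open>busemann\<close> by at least 1 and adds
  at most \<open>m0\<close> to the length. The bound by \<open>m\<close> keeps all intermediate
  elements within reach of \<open>busemann_mult\<close>.\<close>

lemma busemann_reduce:
  assumes k: "k \<in> carrier G" and y: "y \<in> carrier G"
    and km: "len k \<le> m0" and kb: "1 + 4 * \<delta> < \<bar>busemann y k\<bar>"
    and far: "\<And>f. \<lbrakk>f \<in> {k, inv k}\<rbrakk> \<Longrightarrow> far_fixes \<rho> y f"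
    and rho: "3 * m + 2 * \<delta> < \<rho>"
  shows "\<lbrakk>g \<in> carrier G; \<bar>busemann y g\<bar> \<le> m0 + 4 * \<delta> + real n; len g + real (Suc n) * m0 \<le> m\<rbrakk> \<Longrightarrow>
    \<exists>c\<in>generate G {k}. len (c \<otimes> g) \<le> len g + real n * m0 \<and> \<bar>busemann y (c \<otimes> g)\<bar> \<le> m0 + 4 * \<delta>"
proof (induction n arbitrary: g)
  case 0
  then show ?case by (intro bexI[of _ \<one>]) (auto intro: generate.one)
next
  case (Suc n)
  show ?case
  proof (cases "\<bar>busemann y g\<bar> \<le> m0 + 4 * \<delta>")
    case True
    have "0 \<le> m0" using km d_nonneg[of \<one> k] by linarith
    with True Suc.prems show ?thesis by (intro bexI[of _ \<one>]) (auto intro: generate.one)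
  next
    case False
    have m0: "0 \<le> m0" using km d_nonneg[of \<one> k] by linarith
    have bk: "\<bar>busemann y k\<bar> \<le> m0" using busemann_le_len[OF y k] km by linarith
    have "0 \<le> real n * m0" "real (Suc (Suc n)) * m0 = real n * m0 + 2 * m0"
      using m0 by (simp_all add: algebra_simps)
    then have gm: "len g \<le> m" "m0 \<le> m"
      using Suc.prems(3) m0 d_nonneg[of \<one> g] by linarith+
    have ki: "len (inv k) \<le> m0" using km k by simp
    have mult: "\<bar>busemann y (f \<otimes> g) - busemann y f - busemann y g\<bar> \<le> 2 * \<delta>" if "f \<in> {k, inv k}" for f
      using busemann_mult[of f g y m \<rho>] that k y Suc.prems(1) gm km ki far[OF that] rho by auto
    have "\<bar>busemann y (k \<otimes> inv k) - busemann y k - busemann y (inv k)\<bar> \<le> 2 * \<delta>"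
      using busemann_mult[of k "inv k" y m \<rho>] k y gm km ki far[of k] rho by auto
    then have inv_k: "\<bar>busemann y k + busemann y (inv k)\<bar> \<le> 2 * \<delta>"
      using k y by (simp add: busemann_def)
    \<comment> \<open>The factor is chosen to push the value towards 0. Errors total at most
      \<open>4 * \<delta>\<close>, so the step gains 1, and a value beyond
      \<open>m0 + 4 * \<delta>\<close> cannot change sign.\<close>
    have "\<exists>f\<in>{k, inv k}. \<bar>busemann y (f \<otimes> g)\<bar> \<le> \<bar>busemann y g\<bar> - 1"
    proof (cases "(0 < busemann y g) = (0 < busemann y k)")
      case True
      then have "\<bar>busemann y (inv k \<otimes> g)\<bar> \<le> \<bar>busemann y g\<bar> - 1"
        using mult[of "inv k"] inv_k bk kb False delta_nonneg by (auto simp: abs_if split: if_splits)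
      then show ?thesis by blast
    next
      case neq: False
      then have "\<bar>busemann y (k \<otimes> g)\<bar> \<le> \<bar>busemann y g\<bar> - 1"
        using mult[of k] bk kb False delta_nonneg by (auto simp: abs_if split: if_splits)
      then show ?thesis by blast
    qed
    then obtain f where f: "f \<in> {k, inv k}" "\<bar>busemann y (f \<otimes> g)\<bar> \<le> \<bar>busemann y g\<bar> - 1" by blast
    have fc: "f \<in> carrier G" and fm: "len f \<le> m0" using f k km ki by auto
    have fg: "len (f \<otimes> g) \<le> len g + m0" using len_mult_le[of f g] fc fm Suc.prems(1) by simp
    then have "\<exists>c\<in>generate G {k}. len (c \<otimes> (f \<otimes> g)) \<le> len (f \<otimes> g) + real n * m0 \<and>
        \<bar>busemann y (c \<otimes> (f \<otimes> g))\<bar> \<le> m0 + 4 * \<delta>"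
      using Suc.prems f fc by (intro Suc.IH) (auto simp: algebra_simps)
    then obtain c where c: "c \<in> generate G {k}" "len (c \<otimes> (f \<otimes> g)) \<le> len (f \<otimes> g) + real n * m0"
      "\<bar>busemann y (c \<otimes> (f \<otimes> g))\<bar> \<le> m0 + 4 * \<delta>" by blast
    have cc: "c \<in> carrier G" using c k generate_in_carrier[of "{k}"] by blast
    have "c \<otimes> f \<in> generate G {k}"
      using c f by (auto intro: generate.intros)
    then show ?thesis
      using c fg cc fc Suc.prems(1) by (intro bexI[of _ "c \<otimes> f"]) (auto simp: m_assoc algebra_simps)
  qed
qed

end

section \<open>Non-elementary subgroups fix no point at infinity\<close>

text \<open>Finitely many cosets would make the cyclic group generated by \<open>k\<close> a witness
  that \<open>H\<close> is elementary. The case \<open>k = \<one>\<close> gives that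
  \<open>H\<close> is infinite.\<close>

lemma (in group) infinite_rcosets_cyclic:
  assumes H: "subgroup H G" and ne: "\<not> elementary_group (G\<lparr>carrier := H\<rparr>)" and k: "k \<in> H"
  shows "infinite ((\<lambda>g. generate G {k} #> g) ` H)"
proof
  assume fin: "finite ((\<lambda>g. generate G {k} #> g) ` H)"
  let ?C = "generate G {k}"
  have kc: "{k} \<subseteq> carrier G" using k H by (auto dest: subgroup.mem_carrier)
  have C: "subgroup ?C G" using generate_is_subgroup[OF kc] .
  have "?C \<subseteq> H" using generate_subgroup_incl[of "{k}" H] k H by simp
  then have "subgroup ?C (G\<lparr>carrier := H\<rparr>)" using subgroup_incl C H by blast
  moreover have "cyclic_group (G\<lparr>carrier := ?C\<rparr>)"
  proof -
    have kC: "k \<in> ?C" by (auto intro: generate.incl)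
    then have "subgroup_generated (G\<lparr>carrier := ?C\<rparr>) {k} = G\<lparr>carrier := ?C\<rparr>"
      using generate_consistent[of "{k}" ?C] C by (simp add: subgroup_generated_def)
    then show ?thesis using kC by (auto simp: cyclic_group_def)
  qed
  moreover have "rcosets\<^bsub>G\<lparr>carrier := H\<rparr>\<^esub> ?C = (\<lambda>g. ?C #> g) ` H"
    by (auto simp: RCOSETS_def)
  ultimately show False
    using ne fin by (auto simp: elementary_group_def)
qed

context hyperbolic_word_metric
begin

text \<open>If a large finite part of \<open>H\<close> failed for some \<open>y\<close>, its
  elements would almost fix the direction of \<open>y\<close>. Then some \<open>k\<close> in a fixed
  set \<open>E\<close> has a \<open>busemann\<close> value away from 0, and representatives of many
  cosets of its cyclic group reduce to small values, too many for
  \<open>card_busemann_le\<close>.\<close>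

lemma ex_finite_spreading_set:
  assumes H: "subgroup H G" and ne: "\<not> elementary_group (G\<lparr>carrier := H\<rparr>)"
  shows "\<exists>F R. finite F \<and> F \<subseteq> H \<and>
    (\<forall>y\<in>carrier G. \<exists>f\<in>F. \<exists>g\<in>F. almost_between R (f \<otimes> y) \<one> (g \<otimes> y))"
proof -
  have Hc: "H \<subseteq> carrier G" using H by (simp add: subgroup.subset)
  have "infinite H"
    using infinite_rcosets_cyclic[OF H ne, of \<one>] H by (auto simp: subgroup.one_closed)
  \<comment> \<open>One element more than \<open>card_busemann_le\<close> allows for values up to
    \<open>1 + 4 * \<delta>\<close>.\<close>
  then obtain E where E: "finite E" "E \<subseteq> H" "card E = Suc (card (ball (1 + 4 * \<delta> + 6 * \<delta>)))"
    using infinite_arbitrarily_large by blast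
  then obtain m0 where m0: "0 \<le> m0" "E \<subseteq> ball m0"
    using finite_subset_ball[of E] Hc by blast
  let ?N = "card (ball (m0 + 4 * \<delta> + 6 * \<delta>))"
  \<comment> \<open>The element \<open>k\<close> will depend on \<open>y\<close>, so coset
    representatives are fixed in advance for every \<open>k\<close> in the finite set
    \<open>E\<close>.\<close>
  have "\<forall>k\<in>E. \<exists>V. finite V \<and> V \<subseteq> H \<and> card V = Suc ?N \<and> inj_on (\<lambda>g. generate G {k} #> g) V"
  proof
    fix k assume "k \<in> E"
    have "infinite ((\<lambda>g. generate G {k} #> g) ` H)"
      using infinite_rcosets_cyclic[OF H ne] \<open>k \<in> E\<close> E by blast
    from infinite_arbitrarily_large[OF this, of "Suc ?N"]
    obtain T where T: "finite T" "T \<subseteq> (\<lambda>g. generate G {k} #> g) ` H" "card T = Suc ?N"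
      by blast
    then obtain V where "V \<subseteq> H" "inj_on (\<lambda>g. generate G {k} #> g) V"
      "T = (\<lambda>g. generate G {k} #> g) ` V"
      unfolding subset_image_inj by blast
    then show "\<exists>V. finite V \<and> V \<subseteq> H \<and> card V = Suc ?N \<and> inj_on (\<lambda>g. generate G {k} #> g) V"
      using T by (intro exI[of _ V]) (auto simp: card_image dest: finite_imageD)
  qed
  from bchoice[OF this] obtain V where V: "\<And>k. k \<in> E \<Longrightarrow> finite (V k)" "\<And>k. k \<in> E \<Longrightarrow> V k \<subseteq> H"
    "\<And>k. k \<in> E \<Longrightarrow> card (V k) = Suc ?N"
    "\<And>k. k \<in> E \<Longrightarrow> inj_on (\<lambda>g. generate G {k} #> g) (V k)"
    by blast
  have "finite (\<Union>k\<in>E. V k)"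
    using E(1) V(1) by simp
  moreover have "(\<Union>k\<in>E. V k) \<subseteq> carrier G"
    using V(2) Hc by blast
  ultimately obtain r where r: "0 \<le> r" "(\<Union>k\<in>E. V k) \<subseteq> ball r"
    using finite_subset_ball[of "\<Union>k\<in>E. V k"] by blast
  \<comment> \<open>\<open>n\<close> bounds the number of reduction steps, since
    \<open>busemann\<close> is at most \<open>r\<close> on the representatives; \<open>m\<close>
    leaves room for the length that these steps add.\<close>
  define n where "n = nat \<lceil>r\<rceil>"
  define m where "m = nat \<lceil>r + real (n + 1) * m0\<rceil>"
  have n: "r \<le> real n" by (simp add: n_def real_nat_ceiling_ge)
  have m: "r + real (n + 1) * m0 \<le> real m" by (simp add: m_def real_nat_ceiling_ge)
  have "0 \<le> real n * m0" using m0 by simp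
  then have m0m: "m0 \<le> real m" using m r by (simp add: algebra_simps)
  define \<rho> where "\<rho> = 3 * real m + 2 * \<delta> + 1"
  define F where "F = H \<inter> ball m"
  have oneF: "\<one> \<in> F" using H by (simp add: F_def ball_def subgroup.one_closed)
  have "\<exists>f\<in>F. \<exists>g\<in>F. almost_between (\<rho> + m) (f \<otimes> y) \<one> (g \<otimes> y)" if y: "y \<in> carrier G" for y
  proof (rule ccontr)
    assume neg: "\<not> ?thesis"
    have no: "d (f \<otimes> y) (g \<otimes> y) + (\<rho> + m) < d (f \<otimes> y) \<one> + len (g \<otimes> y)"
      if "f \<in> F" "g \<in> F" for f g
    proof -
      have "\<not> almost_between (\<rho> + m) (f \<otimes> y) \<one> (g \<otimes> y)" using that neg by blast
      then show ?thesis by (simp add: almost_between_def)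
    qed
    have Fc: "F \<subseteq> carrier G" using Hc by (auto simp: F_def)
    have Fm: "len f \<le> m" if "f \<in> F" for f using that by (simp add: F_def ball_def)
    \<comment> \<open>Applied to the pair \<open>\<one>\<close>, \<open>f\<close>; the summand
      \<open>m\<close> of the tolerance pays for \<open>len (f \<otimes> y)\<close> exceeding
      \<open>len y\<close>.\<close>
    have far: "far_fixes \<rho> y f" if f: "f \<in> F" for f
    proof -
      have fc: "f \<in> carrier G" using f Fc by auto
      have "d y (f \<otimes> y) + (\<rho> + m) < len y + len (f \<otimes> y)"
        using no[OF oneF f] y d_sym[of y \<one>] by simp
      moreover have "len (f \<otimes> y) \<le> m + len y"
        using len_mult_le[OF fc y] Fm[OF f] by simp
      ultimately show ?thesis by (simp add: far_fixes_def)
    qed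
    \<comment> \<open>The pair \<open>\<one>\<close>, \<open>\<one>\<close> shows that
      \<open>y\<close> itself is far away.\<close>
    have ylen: "\<rho> \<le> 2 * len y" using no[OF oneF oneF] y d_sym[of y \<one>] by simp
    have rho: "3 * real m + 2 * \<delta> < \<rho>" by (simp add: \<rho>_def)
    have EF: "E \<subseteq> F"
      using E m0 ball_mono[OF m0m] by (auto simp: F_def)
    have "\<not> (\<forall>k\<in>E. \<bar>busemann y k\<bar> \<le> 1 + 4 * \<delta>)"
    proof
      assume "\<forall>k\<in>E. \<bar>busemann y k\<bar> \<le> 1 + 4 * \<delta>"
      then have "card E \<le> card (ball (1 + 4 * \<delta> + 6 * \<delta>))"
        using EF Fc Fm far by (intro card_busemann_le[OF y _ _ _ rho ylen]) blast+
      then show False using E by simp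
    qed
    then obtain k where k: "k \<in> E" "1 + 4 * \<delta> < \<bar>busemann y k\<bar>" by (auto simp: not_le)
    have kF: "k \<in> F" and kc: "k \<in> carrier G" and kH: "k \<in> H" using k EF Fc E by auto
    have ikF: "inv k \<in> F"
      using kF kc H by (simp add: F_def ball_def subgroup.m_inv_closed)
    have km0: "len k \<le> m0" using k m0 by (auto simp: ball_def)
    have "\<forall>g\<in>V k. \<exists>c. c \<in> generate G {k} \<and> len (c \<otimes> g) \<le> len g + real n * m0 \<and>
        \<bar>busemann y (c \<otimes> g)\<bar> \<le> m0 + 4 * \<delta>"
    proof
      fix g assume g: "g \<in> V k"
      have gc: "g \<in> carrier G" using g V(2)[OF k(1)] Hc by blast
      have gr: "len g \<le> r" using g r k by (auto simp: ball_def)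
      then have "\<bar>busemann y g\<bar> \<le> m0 + 4 * \<delta> + real n"
        using busemann_le_len[OF y gc] n m0 delta_nonneg by simp
      moreover have "far_fixes \<rho> y f" if "f \<in> {k, inv k}" for f
        using that far kF ikF by blast
      moreover have "len g + real (Suc n) * m0 \<le> m" using gr m by simp
      ultimately have "\<exists>c\<in>generate G {k}. len (c \<otimes> g) \<le> len g + real n * m0 \<and>
          \<bar>busemann y (c \<otimes> g)\<bar> \<le> m0 + 4 * \<delta>"
        using busemann_reduce[OF kc y km0 k(2) _ rho gc] by simp
      then show "\<exists>c. c \<in> generate G {k} \<and> len (c \<otimes> g) \<le> len g + real n * m0 \<and>
          \<bar>busemann y (c \<otimes> g)\<bar> \<le> m0 + 4 * \<delta>" by blast
    qed
    from bchoice[OF this] obtain c where c: "\<And>g. g \<in> V k \<Longrightarrow> c g \<in> generate G {k}"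
      "\<And>g. g \<in> V k \<Longrightarrow> len (c g \<otimes> g) \<le> len g + real n * m0"
      "\<And>g. g \<in> V k \<Longrightarrow> \<bar>busemann y (c g \<otimes> g)\<bar> \<le> m0 + 4 * \<delta>"
      by blast
    let ?W = "(\<lambda>g. c g \<otimes> g) ` V k"
    have C: "subgroup (generate G {k}) G" using generate_is_subgroup kc by simp
    have CH: "generate G {k} \<subseteq> H" using generate_subgroup_incl[of "{k}" H] kH H by simp
    \<comment> \<open>The factors \<open>c g\<close> lie in the cyclic group, so the reduced
      elements stay in the distinct cosets of the representatives and are distinct.\<close>
    have coset: "generate G {k} #> (c g \<otimes> g) = generate G {k} #> g" if g: "g \<in> V k" for g
    proof -
      have "c g \<in> carrier G" "g \<in> carrier G" using c(1)[OF g] CH Hc V(2)[OF k(1)] g by blast+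
      then show ?thesis
        using coset_mult_assoc[of "generate G {k}" "c g" g] coset_join2[of "c g" "generate G {k}"]
          C c(1)[OF g] subgroup.subset[OF C] by simp
    qed
    have "inj_on (\<lambda>g. c g \<otimes> g) (V k)"
    proof (rule inj_onI)
      fix g h assume gh: "g \<in> V k" "h \<in> V k" and eq: "c g \<otimes> g = c h \<otimes> h"
      have "generate G {k} #> g = generate G {k} #> h"
        using coset[OF gh(1)] coset[OF gh(2)] unfolding eq by simp
      then show "g = h" by (rule inj_onD[OF V(4)[OF k(1)] _ gh])
    qed
    then have W: "card ?W = Suc ?N" using V(3)[OF k(1)] by (simp add: card_image)
    have WF: "?W \<subseteq> F"
    proof
      fix w assume "w \<in> ?W"
      then obtain g where g: "g \<in> V k" "w = c g \<otimes> g" by blast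
      have "len g \<le> r" using g r k by (auto simp: ball_def)
      then have "len w \<le> m" using c(2)[OF g(1)] g(2) m m0 by (simp add: algebra_simps)
      moreover have "c g \<in> H" "g \<in> H" using c(1)[OF g(1)] CH V(2)[OF k(1)] g(1) by blast+
      then have "w \<in> H" using g(2) H by (simp add: subgroup.m_closed)
      ultimately show "w \<in> F" using Hc by (auto simp: F_def ball_def)
    qed
    have "card ?W \<le> ?N"
    proof (rule card_busemann_le[OF y _ _ _ rho ylen])
      show "?W \<subseteq> carrier G" using WF Fc by (rule subset_trans)
      fix f assume f: "f \<in> ?W"
      show "len f \<le> m" "far_fixes \<rho> y f" using f WF Fm far by blast+
      show "\<bar>busemann y f\<bar> \<le> m0 + 4 * \<delta>" using f c(3) by blast
    qed
    then show False using W by simp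
  qed
  moreover have "finite F" "F \<subseteq> H" using finite_ball by (auto simp: F_def)
  ultimately show ?thesis by blast
qed

text \<open>
  The two points \<open>f \<otimes> y\<close>, \<open>g \<otimes> y\<close> of a spreading pair cannot both be on the side of \<open>inv x\<close>,
  so one of \<open>x \<otimes> f \<otimes> y\<close>, \<open>x \<otimes> g \<otimes> y\<close> is a concatenation without backtracking.
\<close>

lemma ex_concatenation:
  assumes H: "subgroup H G" and ne: "\<not> elementary_group (G\<lparr>carrier := H\<rparr>)"
  shows "\<exists>r. \<forall>x\<in>H. \<forall>y\<in>H. \<exists>f\<in>H. len f \<le> r \<and> almost_between r \<one> x (x \<otimes> f \<otimes> y)"
proof -
  have Hc: "H \<subseteq> carrier G" using H by (simp add: subgroup.subset)
  obtain F R where F: "finite F" "F \<subseteq> H"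
    "\<And>y. y \<in> carrier G \<Longrightarrow> \<exists>f\<in>F. \<exists>g\<in>F. almost_between R (f \<otimes> y) \<one> (g \<otimes> y)"
    using ex_finite_spreading_set[OF H ne] by blast
  obtain s where s: "0 \<le> s" "F \<subseteq> ball s"
    using finite_subset_ball[of F] F(1,2) Hc by blast
  show ?thesis
  proof (intro exI[of _ "max (R + 2 * \<delta>) s"] ballI)
    fix x y assume "x \<in> H" "y \<in> H"
    then have c: "x \<in> carrier G" "y \<in> carrier G" using Hc by auto
    obtain f g where fg: "f \<in> F" "g \<in> F" "almost_between R (f \<otimes> y) \<one> (g \<otimes> y)"
      using F(3) c by blast
    have fgc: "f \<in> carrier G" "g \<in> carrier G" using fg F Hc by auto
    have "almost_between (R + 2 * \<delta>) (f \<otimes> y) \<one> (inv x) \<or> almost_between (R + 2 * \<delta>) (inv x) \<one> (g \<otimes> y)"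
      using almost_between_split[OF fg(3)] fgc c by simp
    moreover have "almost_between (R + 2 * \<delta>) (inv x) \<one> (f \<otimes> y)"
      if "almost_between (R + 2 * \<delta>) (f \<otimes> y) \<one> (inv x)"
      using that d_sym[of "f \<otimes> y" \<one>] d_sym[of "inv x" \<one>] d_sym[of "inv x" "f \<otimes> y"] fgc c unfolding almost_between_def by simp
    ultimately obtain h where h: "h \<in> F" "almost_between (R + 2 * \<delta>) (inv x) \<one> (h \<otimes> y)"
      using fg by blast
    have hc: "h \<in> carrier G" "len h \<le> s" using h s by (auto simp: ball_def)
    have "almost_between (R + 2 * \<delta>) \<one> x (x \<otimes> h \<otimes> y)"
      using almost_between_left_mult[of x "inv x" \<one> "h \<otimes> y"] h c hc by (simp add: m_assoc)
    then have "almost_between (max (R + 2 * \<delta>) s) \<one> x (x \<otimes> h \<otimes> y)"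
      by (rule almost_between_mono) simp
    then show "\<exists>f\<in>H. len f \<le> max (R + 2 * \<delta>) s \<and> almost_between (max (R + 2 * \<delta>) s) \<one> x (x \<otimes> f \<otimes> y)"
      using h hc F by (intro bexI[of _ h]) auto
  qed
qed

section \<open>Coarsely closed families\<close>

text \<open>
  Elements of \<open>W c\<close> can be cut near any point of a geodesic from \<open>\<one>\<close> to them. If neither \<open>W\<close>
  nor \<open>V\<close> swallows \<open>H\<close>, then neither does their product: a concatenation \<open>x \<otimes> f \<otimes> y\<close>
  with \<open>x\<close> and \<open>y\<close> bad for \<open>W\<close> and \<open>V\<close> cannot be cut into two good pieces.
\<close>

definition coarsely_closed :: "(real \<Rightarrow> 'a set) \<Rightarrow> bool" where
  "coarsely_closed W \<longleftrightarrow> mono W \<and> (\<forall>c. W c \<subseteq> carrier G) \<and> (\<exists>c. \<one> \<in> W c) \<and>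
     (\<forall>c e. \<exists>c'. \<forall>z\<in>W c. \<forall>a\<in>carrier G. almost_between e \<one> a z \<longrightarrow> a \<in> W c' \<and> inv a \<otimes> z \<in> W c')"

lemma coarsely_closedD:
  assumes "coarsely_closed W"
  obtains c' where
    "\<And>z a. \<lbrakk>z \<in> W c; a \<in> carrier G; almost_between e \<one> a z\<rbrakk> \<Longrightarrow> a \<in> W c' \<and> inv a \<otimes> z \<in> W c'"
  using assms unfolding coarsely_closed_def by meson

lemma set_mult_memI: "\<lbrakk>x \<in> U; y \<in> V\<rbrakk> \<Longrightarrow> x \<otimes> y \<in> U <#> V"
  by (auto simp: set_mult_def)

text \<open>Cutting at \<open>w\<close> puts \<open>a\<close> along the first factor or, after
  translation by \<open>inv w\<close>, along the second.\<close>

lemma almost_between_factors: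
  assumes c: "w \<in> carrier G" "v \<in> carrier G" "a \<in> carrier G"
    and "almost_between e \<one> a (w \<otimes> v)"
  shows "almost_between (e + 2 * \<delta>) \<one> a w \<or> almost_between (e + 2 * \<delta>) \<one> (inv w \<otimes> a) v"
  using almost_between_split[OF assms(4) _ _ _ c(1)] c
    almost_between_left_mult[of w \<one> "inv w \<otimes> a" v]
  by (simp add: inv_mult_cancel)

text \<open>A cut of \<open>w \<otimes> v\<close> falls into one of the two factors. The piece on
  the far side of the uncut factor is completed by \<open>\<one>\<close>, which is why some
  \<open>W c\<close> has to contain \<open>\<one>\<close>.\<close>

lemma coarsely_closed_set_mult:
  assumes W: "coarsely_closed W" and V: "coarsely_closed V"
  shows "coarsely_closed (\<lambda>c. W c <#> V c)"
proof -
  have Wc: "W c \<subseteq> carrier G" and Vc: "V c \<subseteq> carrier G" for c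
    using W V by (simp_all add: coarsely_closed_def)
  have W_mono: "W c \<subseteq> W c'" and V_mono: "V c \<subseteq> V c'" if "c \<le> c'" for c c'
    using W V that by (auto simp: coarsely_closed_def mono_def)
  obtain cw cv where one: "\<one> \<in> W cw" "\<one> \<in> V cv"
    using W V by (auto simp: coarsely_closed_def)
  have one_max: "\<one> \<otimes> \<one> \<in> W (max cw cv) <#> V (max cw cv)"
    using one W_mono[of cw "max cw cv"] V_mono[of cv "max cw cv"] by (intro set_mult_memI) auto
  have "\<exists>c'. \<forall>z\<in>W c <#> V c. \<forall>a\<in>carrier G. almost_between e \<one> a z \<longrightarrow>
      a \<in> W c' <#> V c' \<and> inv a \<otimes> z \<in> W c' <#> V c'" for c e
  proof -
    obtain c1 where c1: "\<And>z a. \<lbrakk>z \<in> W c; a \<in> carrier G; almost_between (e + 2 * \<delta>) \<one> a z\<rbrakk>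
        \<Longrightarrow> a \<in> W c1 \<and> inv a \<otimes> z \<in> W c1"
      using coarsely_closedD[OF W] by blast
    obtain c2 where c2: "\<And>z a. \<lbrakk>z \<in> V c; a \<in> carrier G; almost_between (e + 2 * \<delta>) \<one> a z\<rbrakk>
        \<Longrightarrow> a \<in> V c2 \<and> inv a \<otimes> z \<in> V c2"
      using coarsely_closedD[OF V] by blast
    define m where "m = Max {c, c1, c2, cw, cv}"
    have le: "c \<le> m" "c1 \<le> m" "c2 \<le> m" "cw \<le> m" "cv \<le> m" by (simp_all add: m_def)
    have sub: "W c \<subseteq> W m" "V c \<subseteq> V m" "W c1 \<subseteq> W m" "V c2 \<subseteq> V m" "\<one> \<in> W m" "\<one> \<in> V m"
      using one le[THEN W_mono] le[THEN V_mono] by blast+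
    show ?thesis
    proof (intro exI[of _ m] ballI impI)
      fix z a assume z: "z \<in> W c <#> V c" and a: "a \<in> carrier G" and btw: "almost_between e \<one> a z"
      obtain w v where wv: "w \<in> W c" "v \<in> V c" and zwv: "z = w \<otimes> v"
        using z by (auto simp: set_mult_def)
      have c: "w \<in> carrier G" "v \<in> carrier G" using wv Wc Vc by blast+
      show "a \<in> W m <#> V m \<and> inv a \<otimes> z \<in> W m <#> V m"
        using almost_between_factors[OF c a btw[unfolded zwv]]
      proof
        assume "almost_between (e + 2 * \<delta>) \<one> a w"
        then have "a \<in> W m" "inv a \<otimes> w \<in> W m" using c1[OF wv(1) a] sub by auto
        then have "a \<otimes> \<one> \<in> W m <#> V m" "(inv a \<otimes> w) \<otimes> v \<in> W m <#> V m"
          using sub wv by (auto intro!: set_mult_memI)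
        then show ?thesis using a c by (simp add: zwv m_assoc)
      next
        let ?u = "inv w \<otimes> a"
        assume "almost_between (e + 2 * \<delta>) \<one> ?u v"
        then have "?u \<in> V m" "inv ?u \<otimes> v \<in> V m" using c2[OF wv(2), of ?u] sub a c by auto
        then have "w \<otimes> ?u \<in> W m <#> V m" "\<one> \<otimes> (inv ?u \<otimes> v) \<in> W m <#> V m"
          using sub wv by (auto intro!: set_mult_memI)
        then show ?thesis using a c by (simp add: zwv m_assoc inv_mult_group inv_mult_cancel)
      qed
    qed
  qed
  moreover have "mono (\<lambda>c. W c <#> V c)"
    by (intro monoI mono_set_mult W_mono V_mono)
  moreover have "\<exists>c. \<one> \<in> W c <#> V c" using one_max by auto
  ultimately show ?thesis
    unfolding coarsely_closed_def by (intro conjI allI) (auto simp: set_mult_closed Wc Vc)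
qed

lemma not_subset_set_mult:
  assumes H: "subgroup H G" and ne: "\<not> elementary_group (G\<lparr>carrier := H\<rparr>)"
    and W: "coarsely_closed W" "\<And>c. \<not> H \<subseteq> W c"
    and V: "coarsely_closed V" "\<And>c. \<not> H \<subseteq> V c"
  shows "\<not> H \<subseteq> W c <#> V c"
proof
  assume HWV: "H \<subseteq> W c <#> V c"
  have Hc: "H \<subseteq> carrier G" using H by (simp add: subgroup.subset)
  obtain r where r: "\<And>x y. \<lbrakk>x \<in> H; y \<in> H\<rbrakk> \<Longrightarrow>
      \<exists>f\<in>H. len f \<le> r \<and> almost_between r \<one> x (x \<otimes> f \<otimes> y)"
    using ex_concatenation[OF H ne] by blast
  obtain c1 where c1: "\<And>z a. \<lbrakk>z \<in> W c; a \<in> carrier G; almost_between (r + 2 * \<delta>) \<one> a z\<rbrakk>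
      \<Longrightarrow> a \<in> W c1 \<and> inv a \<otimes> z \<in> W c1"
    using coarsely_closedD[OF W(1)] by blast
  \<comment> \<open>The extra \<open>2 * r\<close> pays for moving the cut point by \<open>f\<close>
    below.\<close>
  obtain c2 where c2: "\<And>z a. \<lbrakk>z \<in> V c; a \<in> carrier G; almost_between (r + 2 * \<delta> + 2 * r) \<one> a z\<rbrakk>
      \<Longrightarrow> a \<in> V c2 \<and> inv a \<otimes> z \<in> V c2"
    using coarsely_closedD[OF V(1)] by blast
  obtain x where x: "x \<in> H" "x \<notin> W c1" using W(2) by blast
  obtain y where y: "y \<in> H" "y \<notin> V c2" using V(2) by blast
  obtain f where f: "f \<in> H" "len f \<le> r" "almost_between r \<one> x (x \<otimes> f \<otimes> y)"
    using r x y by blast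
  have "x \<otimes> f \<otimes> y \<in> H" using x f y H by (simp add: subgroup.m_closed)
  then obtain w v where wv: "w \<in> W c" "v \<in> V c" and eq: "x \<otimes> f \<otimes> y = w \<otimes> v"
    using HWV by (auto simp: set_mult_def)
  have c: "x \<in> carrier G" "y \<in> carrier G" "f \<in> carrier G" "w \<in> carrier G" "v \<in> carrier G"
    using x y f wv Hc W(1) V(1) by (auto simp: coarsely_closed_def)
  \<comment> \<open>If \<open>x\<close> lay along \<open>w\<close>, it would belong to
    \<open>W c1\<close>; so the cut falls into \<open>v\<close>.\<close>
  have "\<not> almost_between (r + 2 * \<delta>) \<one> x w" using c1 wv x c by blast
  then have btw: "almost_between (r + 2 * \<delta>) \<one> (inv w \<otimes> x) v"
    using almost_between_factors[of w v x r] c f(3) eq by simp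
  \<comment> \<open>Moving the cut past \<open>f\<close> leaves exactly \<open>y\<close> as the
    final piece of \<open>v\<close>.\<close>
  define a where "a = inv w \<otimes> x \<otimes> f"
  have a: "a \<in> carrier G" using c by (simp add: a_def)
  have "d (inv w \<otimes> x) a \<le> r"
    using d_mult_right[of "inv w \<otimes> x" f] c f(2) by (simp add: a_def)
  then have "almost_between (r + 2 * \<delta> + 2 * r) \<one> a v"
    using btw d_triangle[of \<one> "inv w \<otimes> x" a] d_triangle[of a "inv w \<otimes> x" v]
      d_sym[of a "inv w \<otimes> x"] a c unfolding almost_between_def by simp
  then have "inv a \<otimes> v \<in> V c2" using c2 wv a by blast
  moreover have "inv a \<otimes> v = y"
  proof -
    have "a \<otimes> y = v"
      using eq c by (simp add: a_def m_assoc inv_mult_cancel)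
    then show ?thesis using a c inv_mult_cancel(1)[of a y] by simp
  qed
  ultimately show False using y by simp
qed

text \<open>Balls replace the arbitrary finite sets: each ball is finite, and every finite subset of
  the group lies in one. A single radius makes this an increasing family.\<close>

definition difference_family :: "'a set \<Rightarrow> real \<Rightarrow> 'a set" where
  "difference_family Q c = ball c <#> set_inv Q <#> Q <#> ball c"

lemma difference_familyI:
  "\<lbrakk>b \<in> ball c; p \<in> Q; q \<in> Q; b' \<in> ball c\<rbrakk> \<Longrightarrow> b \<otimes> inv p \<otimes> q \<otimes> b' \<in> difference_family Q c"
  unfolding difference_family_def by (intro set_mult_memI) (auto simp: SET_INV_def)

lemma one_in_ball: "0 \<le> c \<Longrightarrow> \<one> \<in> ball c"
  by (simp add: ball_def)

text \<open>Translation by \<open>p \<otimes> inv b\<close> carries a segment from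
  \<open>\<one>\<close> to \<open>b \<otimes> inv p \<otimes> q \<otimes> b'\<close> to one with
  ends within \<open>c\<close> of \<open>p\<close> and \<open>q\<close>. Coarse convexity gives
  \<open>y\<close> in \<open>Q\<close> near the translated cut point, and inserting \<open>y\<close>
  writes both pieces as products of the same shape.\<close>

lemma coarsely_closed_difference_family:
  assumes Q: "coarsely_convex Q" and ne: "Q \<noteq> {}"
  shows "coarsely_closed (difference_family Q)"
proof -
  have Qc: "Q \<subseteq> carrier G" using Q by (simp add: coarsely_convex_def)
  obtain q0 where q0: "q0 \<in> Q" using ne by blast
  have "\<one> \<in> difference_family Q 0"
    using difference_familyI[OF one_in_ball q0 q0 one_in_ball, of 0] q0 Qc by auto
  moreover have "mono (difference_family Q)"
    unfolding difference_family_def by (intro monoI mono_set_mult ball_mono order_refl)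
  moreover have "difference_family Q c \<subseteq> carrier G" for c
    using Qc ball_carrier unfolding difference_family_def
    by (intro set_mult_closed) (auto simp: SET_INV_def)
  moreover have "\<exists>c'. \<forall>z\<in>difference_family Q c. \<forall>a\<in>carrier G. almost_between e \<one> a z \<longrightarrow>
      a \<in> difference_family Q c' \<and> inv a \<otimes> z \<in> difference_family Q c'" for c e
  proof -
    obtain C where C: "0 \<le> C" "\<And>a b x. \<lbrakk>a \<in> Q; b \<in> Q; x \<in> carrier G;
        almost_between (e + 4 * c) a x b\<rbrakk> \<Longrightarrow> \<exists>y\<in>Q. d x y \<le> C"
      using coarsely_convexD[OF Q, of "e + 4 * c"] by blast
    show ?thesis
    proof (intro exI[of _ "max c C"] ballI impI)
      fix z a
      assume z: "z \<in> difference_family Q c" and a: "a \<in> carrier G" and btw: "almost_between e \<one> a z"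
      obtain b p q b' where zeq: "z = b \<otimes> inv p \<otimes> q \<otimes> b'" and pq: "p \<in> Q" "q \<in> Q"
        and b: "b \<in> ball c" "b' \<in> ball c"
        using z unfolding difference_family_def by (auto simp: set_mult_def SET_INV_def)
      have car: "b \<in> carrier G" "b' \<in> carrier G" "p \<in> carrier G" "q \<in> carrier G"
        using pq b Qc ball_carrier by blast+
      define x where "x = p \<otimes> inv b \<otimes> a"
      have x: "x \<in> carrier G" using car a by (simp add: x_def)
      have "almost_between e (p \<otimes> inv b) x (q \<otimes> b')"
        using btw almost_between_left_mult[of "p \<otimes> inv b" \<one> a z] car a
        by (simp add: x_def zeq m_assoc inv_mult_cancel)
      then have "almost_between (e + 2 * d (p \<otimes> inv b) p + 2 * d (q \<otimes> b') q) p x q"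
        using almost_between_perturb x car by simp
      moreover have "d (p \<otimes> inv b) p \<le> c" "d (q \<otimes> b') q \<le> c"
        using d_sym[of "p \<otimes> inv b" p] d_sym[of "q \<otimes> b'" q] d_mult_right[of p "inv b"]
          d_mult_right[of q b'] car b by (auto simp: ball_def)
      ultimately have "almost_between (e + 4 * c) p x q" by (auto elim: almost_between_mono)
      then obtain y where y: "y \<in> Q" "d x y \<le> C" using C(2) pq x by blast
      have yc: "y \<in> carrier G" using y Qc by auto
      have u: "inv y \<otimes> x \<in> ball (max c C)" "inv x \<otimes> y \<in> ball (max c C)"
        using y x yc d_sym[of x y] d_eq_len[of x y] d_eq_len[of y x] by (auto simp: ball_def)
      have b_max: "b \<in> ball (max c C)" "b' \<in> ball (max c C)"
        using b ball_mono[of c "max c C"] by auto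
      have "b \<otimes> inv p \<otimes> y \<otimes> (inv y \<otimes> x) = a" "inv x \<otimes> y \<otimes> inv y \<otimes> q \<otimes> b' = inv a \<otimes> z"
        using car a yc by (simp_all add: x_def zeq m_assoc inv_mult_group inv_mult_cancel)
      then show "a \<in> difference_family Q (max c C) \<and> inv a \<otimes> z \<in> difference_family Q (max c C)"
        using difference_familyI[OF b_max(1) pq(1) y(1) u(1)] difference_familyI[OF u(2) y(1) pq(2) b_max(2)]
        by simp
    qed
  qed
  ultimately show ?thesis unfolding coarsely_closed_def by blast
qed

text \<open>For \<open>Q <#> S\<close>, the word \<open>p \<otimes> inv s \<otimes> inv q \<otimes>
  q' \<otimes> s' \<otimes> p'\<close> is grouped into parts for \<open>S\<close>, \<open>Q\<close>,
  \<open>S\<close>. For the union, each part goes to its own family and \<open>\<one>\<close> fills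
  the remaining places.\<close>

lemma difference_family_Un_set_mult:
  assumes Q: "Q \<subseteq> carrier G" "Q \<noteq> {}" and S: "S \<subseteq> carrier G" "S \<noteq> {}"
    and P: "finite P1" "P1 \<subseteq> carrier G" "finite P2" "P2 \<subseteq> carrier G"
    and T: "T \<in> {Q \<union> S, Q <#> S}"
  shows "\<exists>c. P1 <#> set_inv T <#> T <#> P2 \<subseteq>
    difference_family S c <#> difference_family Q c <#> difference_family S c"
proof -
  obtain q0 s0 where q0: "q0 \<in> Q" and s0: "s0 \<in> S" using Q S by blast
  have c0: "q0 \<in> carrier G" "s0 \<in> carrier G" using q0 s0 Q S by auto
  \<comment> \<open>Including \<open>q0\<close>, \<open>s0\<close> and their inverses lets a lone
    \<open>p \<otimes> inv t\<close> or \<open>t \<otimes> p\<close> be completed to a product with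
    two elements of the same set.\<close>
  then obtain c where c: "0 \<le> c" "P1 \<union> P2 \<union> {inv q0, q0, inv s0, s0} \<subseteq> ball c"
    using finite_subset_ball[of "P1 \<union> P2 \<union> {inv q0, q0, inv s0, s0}"] P by auto
  let ?Q = "difference_family Q c" and ?S = "difference_family S c"
  have dif: "\<one> \<in> difference_family Y c" "p \<otimes> inv t \<in> difference_family Y c"
    "t \<otimes> p \<in> difference_family Y c" "inv t \<otimes> t' \<in> difference_family Y c"
    "p \<otimes> inv t \<otimes> t' \<otimes> p' \<in> difference_family Y c"
    if Y: "Y \<subseteq> carrier G" "y \<in> Y" "inv y \<in> ball c" "y \<in> ball c"
      and t: "t \<in> Y" "t' \<in> Y" and p: "p \<in> ball c" "p' \<in> ball c" for Y y t t' p p'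
  proof -
    have car: "y \<in> carrier G" "t \<in> carrier G" "t' \<in> carrier G" "p \<in> carrier G" "p' \<in> carrier G"
      using Y t p ball_carrier by auto
    note one = one_in_ball[OF c(1)]
    show "\<one> \<in> difference_family Y c"
      using difference_familyI[OF one Y(2) Y(2) one] car by simp
    show "p \<otimes> inv t \<in> difference_family Y c"
      using difference_familyI[OF p(1) t(1) Y(2) Y(3)] car by (simp add: m_assoc)
    show "t \<otimes> p \<in> difference_family Y c"
      using difference_familyI[OF Y(4) Y(2) t(1) p(1)] car by (simp add: m_assoc)
    show "inv t \<otimes> t' \<in> difference_family Y c"
      using difference_familyI[OF one t one] car by simp
    show "p \<otimes> inv t \<otimes> t' \<otimes> p' \<in> difference_family Y c"
      using difference_familyI[OF p(1) t p(2)] .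
  qed
  note difQ = dif[OF Q(1) q0] and difS = dif[OF S(1) s0]
  have b0: "inv q0 \<in> ball c" "q0 \<in> ball c" "inv s0 \<in> ball c" "s0 \<in> ball c" using c by auto
  have split3: "x \<in> ?S <#> ?Q <#> ?S"
    if "x = u \<otimes> v \<otimes> w" "u \<in> ?S" "v \<in> ?Q" "w \<in> ?S" for x u v w
    using that by (auto intro!: set_mult_memI)
  have "p \<otimes> inv t \<otimes> t' \<otimes> p' \<in> ?S <#> ?Q <#> ?S"
    if p: "p \<in> P1" "p' \<in> P2" and t: "t \<in> T" "t' \<in> T" for p p' t t'
  proof -
    have pb: "p \<in> ball c" "p' \<in> ball c" using p c by auto
    then have pc: "p \<in> carrier G" "p' \<in> carrier G" using ball_carrier by auto
    have Sone: "\<one> \<in> ?S" and Qone: "\<one> \<in> ?Q"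
      using difS(1)[OF b0(3,4) s0 s0 pb] difQ(1)[OF b0(1,2) q0 q0 pb] .
    show ?thesis
    proof (cases "T = Q <#> S")
      case True
      then obtain q s q' s' where t_eq: "t = q \<otimes> s" "t' = q' \<otimes> s'"
        and qs: "q \<in> Q" "q' \<in> Q" "s \<in> S" "s' \<in> S"
        using t by (auto simp: set_mult_def)
      have car: "q \<in> carrier G" "q' \<in> carrier G" "s \<in> carrier G" "s' \<in> carrier G"
        using qs Q S by auto
      show ?thesis
      proof (rule split3)
        show "p \<otimes> inv t \<otimes> t' \<otimes> p' = (p \<otimes> inv s) \<otimes> (inv q \<otimes> q') \<otimes> (s' \<otimes> p')"
          using car pc by (simp add: t_eq m_assoc inv_mult_group)
      qed (use difQ(4)[OF b0(1,2) qs(1,2) pb] difS(2)[OF b0(3,4) qs(3,3) pb]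
            difS(3)[OF b0(3,4) qs(4,4) pb(2,2)] in auto)
    next
      case False
      then have tQS: "t \<in> Q \<union> S" "t' \<in> Q \<union> S" using T t by auto
      then have car: "t \<in> carrier G" "t' \<in> carrier G" using Q S by auto
      consider "t \<in> Q" "t' \<in> Q" | "t \<in> S" "t' \<in> S" | "t \<in> Q" "t' \<in> S" | "t \<in> S" "t' \<in> Q"
        using tQS by blast
      then show ?thesis
      proof cases
        case 1
        then show ?thesis
          using difQ(5)[OF b0(1,2) 1 pb] Sone pc car
          by (intro split3[of _ \<one> "p \<otimes> inv t \<otimes> t' \<otimes> p'" \<one>]) auto
      next
        case 2
        then show ?thesis
          using difS(5)[OF b0(3,4) 2 pb] Sone Qone pc car
          by (intro split3[of _ "p \<otimes> inv t \<otimes> t' \<otimes> p'" \<one> \<one>]) auto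
      next
        case 3
        then show ?thesis
          using difQ(2)[OF b0(1,2) 3(1,1) pb] difS(3)[OF b0(3,4) 3(2,2) pb(2,2)] Sone pc car
          by (intro split3[of _ \<one> "p \<otimes> inv t" "t' \<otimes> p'"]) (auto simp: m_assoc)
      next
        case 4
        then show ?thesis
          using difS(2)[OF b0(3,4) 4(1,1) pb] difQ(3)[OF b0(1,2) 4(2,2) pb(2,2)] Sone pc car
          by (intro split3[of _ "p \<otimes> inv t" "t' \<otimes> p'" \<one>]) (auto simp: m_assoc)
      qed
    qed
  qed
  then have "P1 <#> set_inv T <#> T <#> P2 \<subseteq> ?S <#> ?Q <#> ?S"
    by (subst set_mult_def, subst set_mult_def, subst set_mult_def) (auto simp: SET_INV_def)
  then show ?thesis by blast
qed

end

theorem lemma5p4: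
  fixes G :: "('a, 'b) monoid_scheme" (structure) and A H Q S :: "'a set"
  assumes "hyperbolic_group G A"
    and "subgroup H G" and "\<not> elementary_group (G\<lparr>carrier := H\<rparr>)"
    and "quasiconvex G A Q" and "quasiconvex G A S"
    and "\<And>P1 P2. \<lbrakk>finite P1; P1 \<subseteq> carrier G; finite P2; P2 \<subseteq> carrier G\<rbrakk> \<Longrightarrow>
           \<not> H \<subseteq> P1 <#> set_inv Q <#> Q <#> P2 \<and> \<not> H \<subseteq> P1 <#> set_inv S <#> S <#> P2"
  shows "\<forall>T\<in>{Q \<union> S, Q <#> S}. quasiconvex G A T \<and>
           (\<forall>P1 P2. finite P1 \<and> P1 \<subseteq> carrier G \<and> finite P2 \<and> P2 \<subseteq> carrier G \<longrightarrow>
              \<not> H \<subseteq> P1 <#> set_inv T <#> T <#> P2)"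
proof -
  obtain \<delta> where "group G" "finite_symmetric_generating_set G A" "0 \<le> \<delta>"
    "\<And>w x y z. \<lbrakk>w \<in> carrier G; x \<in> carrier G; y \<in> carrier G; z \<in> carrier G\<rbrakk> \<Longrightarrow>
      gromov_product G A w x z \<ge> min (gromov_product G A w x y) (gromov_product G A w y z) - \<delta>"
    using assms(1) unfolding hyperbolic_group_def by blast
  then interpret hyperbolic_word_metric G A \<delta>
    by (auto intro!: hyperbolic_word_metric.intro word_metric.intro word_metric_axioms.intro
        hyperbolic_word_metric_axioms.intro)
  note H = assms(2) and ne = assms(3)
  have Q: "coarsely_convex Q" and S: "coarsely_convex S"
    using assms(4,5) by (simp_all add: quasiconvex_iff_coarsely_convex)
  have Qc: "Q \<subseteq> carrier G" and Sc: "S \<subseteq> carrier G"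
    using Q S by (simp_all add: coarsely_convex_def)
  have qc: "quasiconvex G A T" if "T \<in> {Q \<union> S, Q <#> S}" for T
    using that coarsely_convex_Un[OF Q S] coarsely_convex_set_mult[OF Q S]
    by (auto simp: quasiconvex_iff_coarsely_convex)
  have "\<not> H \<subseteq> P1 <#> set_inv T <#> T <#> P2"
    if T: "T \<in> {Q \<union> S, Q <#> S}"
      and P: "finite P1" "P1 \<subseteq> carrier G" "finite P2" "P2 \<subseteq> carrier G" for T P1 P2
  proof (cases "Q = {} \<or> S = {}")
    case True
    \<comment> \<open>A product with an empty factor is empty, hence equal to that factor; the union
      is the other set.\<close>
    then have "T = Q \<or> T = S" using T by (auto simp: set_mult_def)
    then show ?thesis using assms(6)[OF P] by auto
  next
    case False
    then have ne': "Q \<noteq> {}" "S \<noteq> {}" by auto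
    note ccQ = coarsely_closed_difference_family[OF Q ne'(1)]
      and ccS = coarsely_closed_difference_family[OF S ne'(2)]
    have HQ: "\<not> H \<subseteq> difference_family Q c" and HS: "\<not> H \<subseteq> difference_family S c" for c
      using assms(6)[OF finite_ball ball_carrier finite_ball ball_carrier]
      unfolding difference_family_def by blast+
    have "\<not> H \<subseteq> difference_family S c <#> difference_family Q c" for c
      by (rule not_subset_set_mult[OF H ne ccS HS ccQ HQ])
    \<comment> \<open>The first product is again a coarsely closed family, so the escape argument
      applies a second time.\<close>
    then have "\<not> H \<subseteq> difference_family S c <#> difference_family Q c <#> difference_family S c" for c
      using not_subset_set_mult[OF H ne coarsely_closed_set_mult[OF ccS ccQ] _ ccS HS] by blast
    then show ?thesis
      using difference_family_Un_set_mult[OF Qc ne'(1) Sc ne'(2) P T] by (meson subset_trans)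
  qed
  then show ?thesis using qc by blast
qed

end
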